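(* Let $G=\mathrm{GIRG}(n,\beta,w_0,d)$ be a standard GIRG and let $k\ge 3$. Let $U_k=\{v_1,\dots,v_k\}$ be a set of $k$ vertices chosen uniformly at random, with weights $w_1\le w_2\le\dots\le w_k$. Let $\mathcal{E}^c_{\mathrm{star}}$ be the event that $v_1$ is adjacent to all vertices of $U_k\setminus\{v_1\}$ and that $w_k\le c^d w_1$, for some constant $c\ge1$ with $c^2\big(w_1^2/(\tau n)\big)^{1/d}\le 1/4$. Then $$\Big(\tfrac12\Big)^{d(k-1)}k^d\ \le\ \Pr\big[U_k\text{ is a clique}\mid \mathcal{E}^c_{\mathrm{star}}\big]\ \le\ c^{d(k-2)}\Big(\tfrac12\Big)^{d(k-1)}k^d.$$
   Context: Fix constants $\lambda>0$, $w_0>0$, $\beta>2$. A standard GIRG $\mathrm{GIRG}(n,\beta,w_0,d)$ has $n$ vertices; each vertex $v$ independently receives a weight $w_v$ with $\Pr[w_v\le x]=1-(x/w_0)^{1-\beta}$ for $x\ge w_0$, and independently a position $\mathbf{x}_v$ uniform on the torus $\mathbb{T}^d=[0,1)^d$. The distance is $d(\mathbf{x}_u,\mathbf{x}_v)=\max_{1\le i\le d}|x_{ui}-x_{vi}|_C$ with $|a-b|_C=\min\{|a-b|,1-|a-b|\}$. Distinct $u,v$ are adjacent iff $d(\mathbf{x}_u,\mathbf{x}_v)\le t_{uv}=\big(\frac{w_uw_v}{\tau n}\big)^{1/d}$, where $\tau=2^d/\lambda$. *)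

theory Defs
  imports "HOL-Probability.Probability"
begin

definition weight_cdf :: "real \<Rightarrow> real \<Rightarrow> real \<Rightarrow> real" where
  "weight_cdf \<beta> w0 x = (if x < w0 then 0 else 1 - (x / w0) powr (1 - \<beta>))"

definition weight_measure :: "real \<Rightarrow> real \<Rightarrow> real measure" where
  "weight_measure \<beta> w0 = interval_measure (weight_cdf \<beta> w0)"

definition torus_measure :: "nat \<Rightarrow> (nat \<Rightarrow> real) measure" where
  "torus_measure d = (\<Pi>\<^sub>M i\<in>{..<d}. uniform_measure lborel {0..<1})"

definition weights_measure :: "nat \<Rightarrow> real \<Rightarrow> real \<Rightarrow> (nat \<Rightarrow> real) measure" where
  "weights_measure n \<beta> w0 = (\<Pi>\<^sub>M v\<in>{..<n}. weight_measure \<beta> w0)"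

definition positions_measure :: "nat \<Rightarrow> nat \<Rightarrow> (nat \<Rightarrow> nat \<Rightarrow> real) measure" where
  "positions_measure n d = (\<Pi>\<^sub>M v\<in>{..<n}. torus_measure d)"

definition k_subsets :: "nat \<Rightarrow> nat \<Rightarrow> nat set set" where
  "k_subsets n k = {U. U \<subseteq> {..<n} \<and> card U = k}"

text \<open>The vertex set is \<open>{..<n}\<close>. An outcome \<open>(w, x, U)\<close> consists of the weights, the positions
  and an independent uniformly random \<open>k\<close>-subset of the vertices; the graph is a function
  of \<open>w\<close> and \<open>x\<close>.\<close>

definition girg_measure ::
  "nat \<Rightarrow> real \<Rightarrow> real \<Rightarrow> nat \<Rightarrow> nat \<Rightarrow> ((nat \<Rightarrow> real) \<times> (nat \<Rightarrow> nat \<Rightarrow> real) \<times> nat set) measure" where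
  "girg_measure n \<beta> w0 d k =
     weights_measure n \<beta> w0 \<Otimes>\<^sub>M (positions_measure n d \<Otimes>\<^sub>M uniform_count_measure (k_subsets n k))"

definition circle_dist :: "real \<Rightarrow> real \<Rightarrow> real" where
  "circle_dist a b = min \<bar>a - b\<bar> (1 - \<bar>a - b\<bar>)"

definition torus_dist :: "nat \<Rightarrow> (nat \<Rightarrow> real) \<Rightarrow> (nat \<Rightarrow> real) \<Rightarrow> real" where
  "torus_dist d a b = Max ((\<lambda>i. circle_dist (a i) (b i)) ` {..<d})"

definition tau :: "real \<Rightarrow> nat \<Rightarrow> real" where
  "tau lam d = 2 ^ d / lam"

definition threshold :: "real \<Rightarrow> nat \<Rightarrow> nat \<Rightarrow> real \<Rightarrow> real \<Rightarrow> real" where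
  "threshold lam n d a b = (a * b / (tau lam d * real n)) powr (1 / real d)"

definition adjacent ::
  "real \<Rightarrow> nat \<Rightarrow> nat \<Rightarrow> (nat \<Rightarrow> real) \<Rightarrow> (nat \<Rightarrow> nat \<Rightarrow> real) \<Rightarrow> nat \<Rightarrow> nat \<Rightarrow> bool" where
  "adjacent lam n d w x u v \<longleftrightarrow>
     u \<noteq> v \<and> torus_dist d (x u) (x v) \<le> threshold lam n d (w u) (w v)"

definition is_clique ::
  "real \<Rightarrow> nat \<Rightarrow> nat \<Rightarrow> (nat \<Rightarrow> real) \<Rightarrow> (nat \<Rightarrow> nat \<Rightarrow> real) \<Rightarrow> nat set \<Rightarrow> bool" where
  "is_clique lam n d w x U \<longleftrightarrow> (\<forall>u\<in>U. \<forall>v\<in>U. u \<noteq> v \<longrightarrow> adjacent lam n d w x u v)"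

text \<open>The enumeration \<open>v\<^sub>1, \<dots>, v\<^sub>k\<close> of \<open>U\<close> by increasing weight, with indices starting at \<open>0\<close>.
  The sort is stable, so ties (which have probability zero) are broken by vertex label.\<close>

definition by_weight :: "(nat \<Rightarrow> real) \<Rightarrow> nat set \<Rightarrow> nat list" where
  "by_weight w U = sort_key w (sorted_list_of_set U)"

text \<open>As \<open>w\<^sub>1\<close> is random, the constraint relating \<open>c\<close> and \<open>w\<^sub>1\<close> belongs to the event.\<close>

definition weight_condition ::
  "real \<Rightarrow> nat \<Rightarrow> nat \<Rightarrow> real \<Rightarrow> (nat \<Rightarrow> real) \<Rightarrow> nat set \<Rightarrow> bool" where
  "weight_condition lam n d c w U \<longleftrightarrow>
     (let w1 = w (hd (by_weight w U)); wk = w (last (by_weight w U)) in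
        wk \<le> c ^ d * w1 \<and> c\<^sup>2 * (w1\<^sup>2 / (tau lam d * real n)) powr (1 / real d) \<le> 1 / 4)"

definition star_event ::
  "real \<Rightarrow> nat \<Rightarrow> nat \<Rightarrow> real \<Rightarrow> (nat \<Rightarrow> real) \<Rightarrow> (nat \<Rightarrow> nat \<Rightarrow> real) \<Rightarrow> nat set \<Rightarrow> bool" where
  "star_event lam n d c w x U \<longleftrightarrow>
     (let v1 = hd (by_weight w U) in \<forall>u\<in>U - {v1}. adjacent lam n d w x v1 u) \<and>
     weight_condition lam n d c w U"

end

theory Submission
  imports Defs
begin

text \<open>
  Fix the weights. The distance is a maximum over independent coordinates, so both the star and the
  clique event are \<open>d\<close>-fold products and the conditional probability is \<open>q ^ d\<close> for a one-dimensional
  probability \<open>q\<close>. With \<open>r = (w\<^sub>1\<^sup>2 / (\<tau> n)) powr (1 / d)\<close> and \<open>a\<^sub>j = (w\<^sub>j / w\<^sub>1) powr (1 / d) \<in> [1, c]\<close>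
  the thresholds are \<open>a\<^sub>i a\<^sub>j r\<close>. Given the star, the other vertices lie at \<open>p + a\<^sub>j r z\<^sub>j\<close>, where \<open>p\<close> is the
  position of \<open>v\<^sub>1\<close> and the \<open>z\<^sub>j\<close> are independent and uniform on \<open>[-1, 1]\<close>; since \<open>c\<^sup>2 r \<le> 1 / 4\<close>, nothing
  wraps around the circle and \<open>q\<close> is the probability that \<open>\<bar>a\<^sub>i z\<^sub>i - a\<^sub>j z\<^sub>j\<bar> \<le> a\<^sub>i a\<^sub>j\<close> for all \<open>i, j\<close>.
  This event contains \<open>{range z \<le> 1}\<close> and is contained in \<open>{range z \<le> c}\<close>. Splitting by the index of
  the minimum, \<open>m = k - 1\<close> uniform points have range at most \<open>c \<le> 2\<close> with probability
  \<open>(2 m c ^ (m - 1) - (m - 1) c ^ m) / 2 ^ m\<close>, which is \<open>k / 2 ^ (k - 1)\<close> for \<open>c = 1\<close> and at most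
  \<open>c ^ (k - 2) k / 2 ^ (k - 1)\<close> in general. The unconditional bounds follow by integrating over the
  weights and the choice of \<open>U\<close>.
\<close>

subsection \<open>Independence of the coordinates\<close>

text \<open>Coordinates of a product measure are independent, and functions of disjoint groups of
  them stay independent; injectivity of \<open>case_prod g\<close> makes the groups disjoint. A
  general \<open>g\<close> allows both index orders, \<open>(i, j)\<close> for rows and
  \<open>(j, i)\<close> for columns.\<close>

lemma indep_vars_PiM_blocks:
  fixes g :: "'i \<Rightarrow> 'j \<Rightarrow> 'k"
  assumes M: "prob_space M" and I: "I \<noteq> {}" and K: "K \<noteq> {}"
    and inj: "inj_on (case_prod g) (I \<times> J)" and g: "\<And>i j. i \<in> I \<Longrightarrow> j \<in> J \<Longrightarrow> g i j \<in> K"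
  shows "prob_space.indep_vars (\<Pi>\<^sub>M k\<in>K. M) (\<lambda>_. \<Pi>\<^sub>M j\<in>J. M) (\<lambda>i f. \<lambda>j\<in>J. f (g i j)) I"
proof -
  let ?N = "\<Pi>\<^sub>M k\<in>K. M"
  interpret N: prob_space ?N by (intro prob_space_PiM M)
  \<comment> \<open>The identity appears as a tuple of coordinates because independence is
    characterised by the joint law of such a tuple being the product of the marginals.\<close>
  have "distr ?N ?N (\<lambda>x. \<lambda>i\<in>K. x i) = distr ?N ?N (\<lambda>x. x)"
    by (intro distr_cong) (auto simp: space_PiM)
  also have "\<dots> = (\<Pi>\<^sub>M k\<in>K. distr ?N M (\<lambda>f. f k))"
    by (auto simp: distr_id intro!: PiM_cong distr_PiM_component[symmetric] M)
  finally have "N.indep_vars (\<lambda>_. M) (\<lambda>k f. f k) K"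
    by (subst N.indep_vars_iff_distr_eq_PiM'[OF K]) auto
  then have "N.indep_vars (\<lambda>i. PiM (g i ` J) (\<lambda>_. M)) (\<lambda>i f. restrict (\<lambda>k. f k) (g i ` J)) I"
    by (rule N.indep_vars_restrict)
      (use g inj in \<open>force simp: disjoint_family_on_def inj_on_def\<close>)+
  then have "N.indep_vars (\<lambda>_. \<Pi>\<^sub>M j\<in>J. M)
      (\<lambda>i f. (\<lambda>h. \<lambda>j\<in>J. h (g i j)) (restrict (\<lambda>k. f k) (g i ` J))) I"
    by (rule N.indep_vars_compose2) (intro measurable_restrict measurable_component_singleton imageI)
  then show ?thesis
    by (rule N.indep_vars_cong[THEN iffD1, rotated -1]) (auto simp: fun_eq_iff)
qed

text \<open>The rows of a doubly indexed independent family are independent and each has the product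
  law over \<open>J\<close>, so currying a flat product gives the iterated one.\<close>

lemma distr_PiM_Times:
  assumes M: "prob_space M" and I: "I \<noteq> {}" and J: "J \<noteq> {}"
  shows "distr (\<Pi>\<^sub>M k\<in>I \<times> J. M) (\<Pi>\<^sub>M i\<in>I. \<Pi>\<^sub>M j\<in>J. M) (\<lambda>f. \<lambda>i\<in>I. \<lambda>j\<in>J. f (i, j)) =
    (\<Pi>\<^sub>M i\<in>I. \<Pi>\<^sub>M j\<in>J. M)"
proof -
  let ?N = "\<Pi>\<^sub>M k\<in>I \<times> J. M"
  interpret N: prob_space ?N by (intro prob_space_PiM M)
  have *: "N.indep_vars (\<lambda>_. \<Pi>\<^sub>M j\<in>J. M) (\<lambda>i f. \<lambda>j\<in>J. f (i, j)) I"
    by (rule indep_vars_PiM_blocks[OF M]) (use I J in \<open>auto simp: inj_on_def\<close>)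
  have "distr ?N (\<Pi>\<^sub>M i\<in>I. \<Pi>\<^sub>M j\<in>J. M) (\<lambda>f. \<lambda>i\<in>I. \<lambda>j\<in>J. f (i, j)) =
    (\<Pi>\<^sub>M i\<in>I. distr ?N (\<Pi>\<^sub>M j\<in>J. M) (\<lambda>f. \<lambda>j\<in>J. f (i, j)))"
    by (rule N.indep_vars_iff_distr_eq_PiM'[OF I, THEN iffD1, OF _ *])
      (auto intro!: measurable_restrict measurable_component_singleton)
  also have "\<dots> = (\<Pi>\<^sub>M i\<in>I. \<Pi>\<^sub>M j\<in>J. M)"
    by (intro PiM_cong refl distr_PiM_reindex M) (auto simp: inj_on_def)
  finally show ?thesis .
qed

text \<open>Uncurrying to a flat product over \<open>J \<times> I\<close> makes the columns
  independent with a common law, so the probability splits into \<open>card I\<close> equal factors.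
  This is the source of the \<open>d\<close>-th powers.\<close>

lemma measure_PiM_PiM_columns:
  assumes M: "prob_space M" and I: "I \<noteq> {}" "finite I" and J: "J \<noteq> {}"
    and A: "A \<in> sets (\<Pi>\<^sub>M j\<in>J. M)"
  shows "measure (\<Pi>\<^sub>M j\<in>J. \<Pi>\<^sub>M i\<in>I. M)
      {x \<in> space (\<Pi>\<^sub>M j\<in>J. \<Pi>\<^sub>M i\<in>I. M). \<forall>i\<in>I. (\<lambda>j\<in>J. x j i) \<in> A} =
    measure (\<Pi>\<^sub>M j\<in>J. M) A ^ card I"
proof -
  let ?N = "\<Pi>\<^sub>M k\<in>J \<times> I. M" and ?P = "\<Pi>\<^sub>M j\<in>J. \<Pi>\<^sub>M i\<in>I. M" and ?Q = "\<Pi>\<^sub>M j\<in>J. M"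
  let ?X = "\<lambda>i f. \<lambda>j\<in>J. f (j, i)"
  interpret N: prob_space ?N by (intro prob_space_PiM M)
  have ind: "N.indep_vars (\<lambda>_. ?Q) ?X I"
    by (rule indep_vars_PiM_blocks[OF M]) (use I J in \<open>auto simp: inj_on_def\<close>)
  have X: "?X i \<in> measurable ?N ?Q" if "i \<in> I" for i
    using that by (auto intro!: measurable_restrict measurable_component_singleton)
  have Y: "(\<lambda>x. \<lambda>j\<in>J. x j i) \<in> measurable ?P ?Q" if "i \<in> I" for i
    using that by (intro measurable_restrict)
      (auto intro!: measurable_compose[OF measurable_component_singleton[of _ J]]
        measurable_component_singleton)
  have meas: "{x \<in> space ?P. \<forall>i\<in>I. (\<lambda>j\<in>J. x j i) \<in> A} \<in> sets ?P"
    by (intro sets.sets_Collect_finite_All I measurable_sets_Collect[OF Y]) (use A in auto)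
  have [measurable]: "(\<lambda>f. \<lambda>j\<in>J. \<lambda>i\<in>I. f (j, i)) \<in> measurable ?N ?P"
    by (auto intro!: measurable_restrict measurable_component_singleton)
  have dist: "distr ?N ?Q (?X i) = ?Q" if "i \<in> I" for i
    using that by (intro distr_PiM_reindex M) (auto simp: inj_on_def)
  have "measure ?P {x \<in> space ?P. \<forall>i\<in>I. (\<lambda>j\<in>J. x j i) \<in> A} =
    measure ?N (\<Inter>i\<in>I. ?X i -` A \<inter> space ?N)"
  proof (subst distr_PiM_Times[OF M J I(1), symmetric], subst measure_distr)
    show "measure ?N ((\<lambda>f. \<lambda>j\<in>J. \<lambda>i\<in>I. f (j, i)) -` {x \<in> space ?P. \<forall>i\<in>I. (\<lambda>j\<in>J. x j i) \<in> A} \<inter> space ?N) =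
      measure ?N (\<Inter>i\<in>I. ?X i -` A \<inter> space ?N)"
      using I(1) by (intro arg_cong[where f="measure _"])
        (auto simp: space_PiM PiE_iff cong: restrict_cong)
  qed (use meas in auto)
  also have "\<dots> = (\<Prod>i\<in>I. measure ?N (?X i -` A \<inter> space ?N))"
    by (rule N.indep_varsD[OF ind I subset_refl A])
  also have "\<dots> = (\<Prod>i\<in>I. measure ?Q A)"
    by (intro prod.cong refl) (metis measure_distr[OF X A] dist)
  finally show ?thesis by simp
qed

subsection \<open>The range of uniform points\<close>

lemma uniform_Icc_prob_space: "prob_space (uniform_measure lborel {-1..1::real})"
  by (rule prob_space_uniform_measure) auto

lemma nn_integral_uniform_Icc:
  assumes [measurable]: "f \<in> borel_measurable borel"
  shows "(\<integral>\<^sup>+s. f s \<partial>uniform_measure lborel {-1..1::real}) =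
    ennreal (1/2) * (\<integral>\<^sup>+s. f s * indicator {-1..1} s \<partial>lborel)"
  by (subst nn_integral_uniform_measure)
    (auto simp: divide_ennreal_def mult.commute inverse_ennreal[of 2, simplified])

text \<open>Fubini on coordinate \<open>i\<close>: once \<open>z i = s\<close> is fixed, the other
  \<open>card J - 1\<close> coordinates fall independently into the window \<open>W s\<close>. It is
  used with windows just above \<open>s\<close>, so that \<open>i\<close> becomes the index of the
  minimum.\<close>

lemma emeasure_PiM_window:
  fixes W :: "real \<Rightarrow> real set"
  assumes M: "prob_space M" and [measurable_cong, simp]: "sets M = sets borel"
    and J: "finite J" "i \<in> J"
    and W: "Measurable.pred (borel \<Otimes>\<^sub>M borel) (\<lambda>(s, t). t \<in> W s)"
  shows "{z \<in> space (\<Pi>\<^sub>M j\<in>J. M). \<forall>j\<in>J - {i}. z j \<in> W (z i)} \<in> sets (\<Pi>\<^sub>M j\<in>J. M)" (is "?S \<in> _")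
    and "emeasure (\<Pi>\<^sub>M j\<in>J. M) {z \<in> space (\<Pi>\<^sub>M j\<in>J. M). \<forall>j\<in>J - {i}. z j \<in> W (z i)} =
      (\<integral>\<^sup>+s. emeasure M (W s) ^ (card J - 1) \<partial>M)"
proof -
  interpret M: prob_space M by fact
  interpret product_prob_space "\<lambda>_. M" by unfold_locales
  have [simp]: "space M = UNIV" using sets_eq_imp_space_eq[of M borel] by simp
  have Ws: "W s \<in> sets M" for s
  proof -
    have "Measurable.pred borel (\<lambda>t. case (s, t) of (s, t) \<Rightarrow> t \<in> W s)"
      by (rule measurable_compose[OF _ W]) simp
    then show ?thesis by (simp add: pred_def)
  qed
  have m: "Measurable.pred (\<Pi>\<^sub>M j\<in>J. M) (\<lambda>z. z j \<in> W (z i))" if "j \<in> J" for j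
  proof -
    have "(\<lambda>z. (z i, z j)) \<in> (\<Pi>\<^sub>M j\<in>J. M) \<rightarrow>\<^sub>M borel \<Otimes>\<^sub>M borel"
      using J that by measurable
    from measurable_compose[OF this W] show ?thesis by simp
  qed
  show S: "?S \<in> sets (\<Pi>\<^sub>M j\<in>J. M)"
    by (rule sets.sets_Collect_finite_All) (use m J in \<open>auto simp: pred_def\<close>)
  let ?J = "J - {i}"
  have ins: "insert i ?J = J" using J by auto
  have "emeasure (\<Pi>\<^sub>M j\<in>J. M) ?S = (\<integral>\<^sup>+z. indicator ?S z \<partial>(\<Pi>\<^sub>M j\<in>insert i ?J. M))"
    unfolding ins using S by simp
  also have "\<dots> = (\<integral>\<^sup>+s. (\<integral>\<^sup>+z. indicator ?S (z(i := s)) \<partial>(\<Pi>\<^sub>M j\<in>?J. M)) \<partial>M)"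
    using J S by (intro product_nn_integral_insert_rev) (auto simp: ins simp del: insert_Diff_single)
  also have "\<dots> = (\<integral>\<^sup>+s. emeasure M (W s) ^ (card J - 1) \<partial>M)"
  proof (rule nn_integral_cong)
    fix s
    have "(\<integral>\<^sup>+z. indicator ?S (z(i := s)) \<partial>(\<Pi>\<^sub>M j\<in>?J. M)) =
      (\<integral>\<^sup>+z. indicator (\<Pi>\<^sub>E j\<in>?J. W s) z \<partial>(\<Pi>\<^sub>M j\<in>?J. M))"
      using J by (intro nn_integral_cong)
        (auto simp: indicator_def space_PiM PiE_iff extensional_def)
    also have "\<dots> = (\<Prod>j\<in>?J. emeasure M (W s))"
      using J Ws by (subst nn_integral_indicator) (auto intro!: sets_PiM_I_finite simp: emeasure_PiM)
    finally show "(\<integral>\<^sup>+z. indicator ?S (z(i := s)) \<partial>(\<Pi>\<^sub>M j\<in>?J. M)) = emeasure M (W s) ^ (card J - 1)"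
      using J by simp
  qed
  finally show "emeasure (\<Pi>\<^sub>M j\<in>J. M) ?S = (\<integral>\<^sup>+s. emeasure M (W s) ^ (card J - 1) \<partial>M)" .
qed

text \<open>\<open>min c (1 - s) / 2\<close> is the probability that a uniform point of
  \<open>[-1, 1]\<close> lies in \<open>[s, s + c]\<close>. The integral is thus the probability
  that one given point out of \<open>m\<close> is the minimum and the others exceed it by at most
  \<open>c\<close>.\<close>

lemma nn_integral_min_power:
  fixes c :: real and m :: nat
  assumes c: "0 < c" "c \<le> 2" and m: "m \<ge> 1"
  shows "(\<integral>\<^sup>+s. ennreal (min c (1 - s) / 2) ^ (m - 1) \<partial>uniform_measure lborel {-1..1}) =
    ennreal ((2 * m * c ^ (m - 1) - (m - 1) * c ^ m) / (m * 2 ^ m))"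
proof -
  obtain l where l: "m = Suc l" using m by (cases m) auto
  \<comment> \<open>The minimum switches branch at \<open>1 - c\<close>, which is at least
    \<open>-1\<close> because \<open>c \<le> 2\<close>. This point belongs to both intervals, so the
    integrands agree only almost everywhere.\<close>
  have "(\<integral>\<^sup>+s. ennreal (min c (1 - s) / 2) ^ (m - 1) * indicator {-1..1} s \<partial>lborel) =
    (\<integral>\<^sup>+s. ennreal ((c / 2) ^ l) * indicator {-1..1-c} s + ennreal (((1 - s) / 2) ^ l) * indicator {1-c..1} s \<partial>lborel)"
    using c by (intro nn_integral_cong_AE eventually_mono[OF AE_lborel_singleton[of "1 - c"]])
      (auto simp: indicator_def l ennreal_power min_def)
  also have "\<dots> = ennreal ((c / 2) ^ l) * ennreal (2 - c) + (\<integral>\<^sup>+s. ennreal (((1 - s) / 2) ^ l) * indicator {1-c..1} s \<partial>lborel)"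
    using c by (subst nn_integral_add) (auto simp: nn_integral_cmult_indicator)
  also have "(\<integral>\<^sup>+s. ennreal (((1 - s) / 2) ^ l) * indicator {1-c..1} s \<partial>lborel) =
     ennreal ((- 2 * ((1 - 1) / 2) ^ m / m) - (- 2 * ((1 - (1 - c)) / 2) ^ m / m))"
  proof (rule nn_integral_FTC_Icc)
    show "((\<lambda>s. - 2 * ((1 - s) / 2) ^ m / m) has_real_derivative ((1 - s) / 2) ^ l) (at s)" for s :: real
      unfolding l by (auto intro!: derivative_eq_intros simp del: of_nat_Suc power_Suc)
  qed (use c in auto)
  also have "\<dots> = ennreal (2 * (c / 2) ^ m / m)"
    using m by (simp add: l)
  also have "ennreal ((c / 2) ^ l) * ennreal (2 - c) + \<dots> = ennreal ((c / 2) ^ l * (2 - c) + 2 * (c / 2) ^ m / m)"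
    using c by (simp add: ennreal_mult'[symmetric] ennreal_plus[symmetric] del: ennreal_plus)
  finally have "(\<integral>\<^sup>+s. ennreal (min c (1 - s) / 2) ^ (m - 1) \<partial>uniform_measure lborel {-1..1}) =
      ennreal (1/2) * ennreal ((c / 2) ^ l * (2 - c) + 2 * (c / 2) ^ m / m)"
    by (subst nn_integral_uniform_Icc) auto
  also have "\<dots> = ennreal (1/2 * ((c / 2) ^ l * (2 - c) + 2 * (c / 2) ^ m / m))"
    by (rule ennreal_mult'[symmetric]) simp
  also have "1/2 * ((c / 2) ^ l * (2 - c) + 2 * (c / 2) ^ m / m) =
      (2 * m * c ^ (m - 1) - (m - 1) * c ^ m) / (m * 2 ^ m)"
  proof -
    have "c ^ m = c * c ^ l" "(2::real) ^ m = 2 * 2 ^ l" "m - 1 = l" "real l = real m - 1" "real m \<noteq> 0"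
      by (auto simp: l)
    moreover have "c * c ^ l + c * (real l * c ^ l) = c * (real m * c ^ l)"
      by (simp add: l algebra_simps)
    ultimately show ?thesis by (simp add: power_divide field_simps)
  qed
  finally show ?thesis .
qed

text \<open>Some \<open>z i\<close> is smallest, so a union bound over the window events of all
  \<open>i\<close> suffices; ties are merely counted more than once. For \<open>c \<ge> 2\<close>
  the claimed bound is at least \<open>1\<close>.\<close>

lemma emeasure_range_le:
  fixes J :: "'j set" and c :: real
  assumes J: "finite J" "J \<noteq> {}" and c: "c \<ge> 1"
  defines "R \<equiv> \<Pi>\<^sub>M j\<in>J. uniform_measure lborel {-1..1::real}"
  shows "emeasure R {z \<in> space R. \<forall>i\<in>J. \<forall>j\<in>J. \<bar>z i - z j\<bar> \<le> c} \<le>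
    ennreal (c ^ (card J - 1) * (card J + 1) / 2 ^ card J)" (is "emeasure R ?S \<le> ennreal ?b")
proof -
  let ?u = "uniform_measure lborel {-1..1::real}"
  interpret R: prob_space R unfolding R_def by (intro prob_space_PiM uniform_Icc_prob_space)
  define m where "m = card J"
  have m: "m \<ge> 1" using J by (simp add: m_def Suc_leI card_gt_0_iff)
  show ?thesis
  proof (cases "c \<ge> 2")
    case True
    have "2 ^ m = 2 ^ (m - 1) * (2::real)"
      using m by (cases m) auto
    also have "\<dots> \<le> c ^ (m - 1) * (m + 1)"
      using True m by (intro mult_mono power_mono) auto
    finally have "1 \<le> ?b" by (simp add: m_def)
    then show ?thesis using R.emeasure_le_1[of ?S] by (meson ennreal_ge_1 order_trans)
  next
    case False
    let ?B = "\<lambda>i. {z \<in> space R. \<forall>j\<in>J - {i}. z j \<in> {z i .. z i + c}}"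
    have W: "Measurable.pred (borel \<Otimes>\<^sub>M borel) (\<lambda>(s, t). t \<in> {s .. s + c})"
      unfolding atLeastAtMost_iff by measurable
    note B = emeasure_PiM_window[OF uniform_Icc_prob_space _ J(1) _ W, folded R_def]
    have "?S \<subseteq> (\<Union>i\<in>J. ?B i)"
    proof
      fix z assume z: "z \<in> ?S"
      obtain i where i: "i \<in> J" "\<forall>j\<in>J. z i \<le> z j"
        using J ex_min_if_finite[of "z ` J"] by (metis finite_imageI image_is_empty imageE imageI not_le)
      have "z \<in> ?B i" using z i by force
      then show "z \<in> (\<Union>i\<in>J. ?B i)" using i by blast
    qed
    then have "emeasure R ?S \<le> emeasure R (\<Union>i\<in>J. ?B i)"
      using B(1) J by (intro emeasure_mono sets.finite_UN) auto
    also have "\<dots> \<le> (\<Sum>i\<in>J. emeasure R (?B i))"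
      using B(1) J by (intro emeasure_subadditive_finite) auto
    also have "\<dots> = (\<Sum>i\<in>J. ennreal ((2 * m * c ^ (m - 1) - (m - 1) * c ^ m) / (m * 2 ^ m)))"
    proof (intro sum.cong refl)
      fix i assume "i \<in> J"
      then have "emeasure R (?B i) = (\<integral>\<^sup>+s. emeasure ?u {s .. s + c} ^ (m - 1) \<partial>?u)"
        by (subst B(2)) (auto simp: m_def)
      also have "\<dots> = (\<integral>\<^sup>+s. ennreal (min c (1 - s) / 2) ^ (m - 1) \<partial>?u)"
      proof (rule nn_integral_cong_AE)
        have "emeasure ?u {s .. s + c} = ennreal (min c (1 - s) / 2)" if "s \<in> {-1..1}" for s
        proof -
          have "{-1..1} \<inter> {s .. s + c} = {s .. s + min c (1 - s)}" using that by auto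
          then show ?thesis using that c by (simp add: divide_ennreal flip: ennreal_numeral)
        qed
        then show "AE s in ?u. emeasure ?u {s .. s + c} ^ (m - 1) = ennreal (min c (1 - s) / 2) ^ (m - 1)"
          by (intro AE_uniform_measureI) auto
      qed
      also have "\<dots> = ennreal ((2 * m * c ^ (m - 1) - (m - 1) * c ^ m) / (m * 2 ^ m))"
        using c False m by (intro nn_integral_min_power) auto
      finally show "emeasure R (?B i) = \<dots>" .
    qed
    also have "\<dots> = ennreal ((2 * m * c ^ (m - 1) - (m - 1) * c ^ m) / 2 ^ m)"
      using m by (simp add: m_def[symmetric] ennreal_of_nat_eq_real_of_nat ennreal_mult'[symmetric])
    also have "\<dots> \<le> ennreal ?b"
    proof -
      \<comment> \<open>As \<open>c \<ge> 1\<close>, lowering \<open>c ^ m\<close> to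
        \<open>c ^ (m - 1)\<close> in the subtracted term only increases the value, and
        \<open>2 * m - (m - 1) = m + 1\<close>.\<close>
      have "(m - 1) * c ^ (m - 1) * 1 \<le> (m - 1) * c ^ (m - 1) * c"
        using c by (intro mult_left_mono) auto
      also have "(m - 1) * c ^ (m - 1) * c = (m - 1) * c ^ m"
        using m by (cases m) auto
      finally have "2 * m * c ^ (m - 1) - (m - 1) * c ^ m \<le> c ^ (m - 1) * (m + 1)"
        using m by (simp add: of_nat_diff algebra_simps)
      then show ?thesis unfolding m_def[symmetric] by (intro ennreal_leI divide_right_mono) auto
    qed
    finally show ?thesis .
  qed
qed

text \<open>Windows open on the left make the events that \<open>i\<close> is the strict minimum
  disjoint, so their probabilities add up. Each is the integral above at \<open>c = 1\<close>, that
  is \<open>(m + 1) / (m * 2 ^ m)\<close>, and there are \<open>m\<close> of them.\<close>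

lemma emeasure_range_ge:
  fixes J :: "'j set"
  assumes J: "finite J" "card J \<ge> 2"
  defines "R \<equiv> \<Pi>\<^sub>M j\<in>J. uniform_measure lborel {-1..1::real}"
  shows "ennreal ((card J + 1) / 2 ^ card J) \<le>
    emeasure R {z \<in> space R. \<forall>i\<in>J. \<forall>j\<in>J. \<bar>z i - z j\<bar> \<le> 1}" (is "_ \<le> emeasure R ?S")
proof -
  let ?u = "uniform_measure lborel {-1..1::real}"
  define m where "m = card J"
  have m: "m \<ge> 2" using J by (simp add: m_def)
  let ?B = "\<lambda>i. {z \<in> space R. \<forall>j\<in>J - {i}. z j \<in> {z i <.. z i + 1}}"
  have W: "Measurable.pred (borel \<Otimes>\<^sub>M borel) (\<lambda>(s, t). t \<in> {s <.. s + 1 :: real})"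
    unfolding greaterThanAtMost_iff by measurable
  note B = emeasure_PiM_window[OF uniform_Icc_prob_space _ J(1) _ W, folded R_def]
  have "ennreal ((m + 1) / 2 ^ m) = (\<Sum>i\<in>J. ennreal ((2 * m * (1::real) ^ (m - 1) - (m - 1) * 1 ^ m) / (m * 2 ^ m)))"
    using m by (simp add: m_def[symmetric] ennreal_of_nat_eq_real_of_nat ennreal_mult'[symmetric] of_nat_diff)
  also have "\<dots> = (\<Sum>i\<in>J. emeasure R (?B i))"
  proof (intro sum.cong refl)
    fix i assume "i \<in> J"
    then have "emeasure R (?B i) = (\<integral>\<^sup>+s. emeasure ?u {s <.. s + 1} ^ (m - 1) \<partial>?u)"
      by (subst B(2)) (auto simp: m_def)
    also have "\<dots> = (\<integral>\<^sup>+s. ennreal (min 1 (1 - s) / 2) ^ (m - 1) \<partial>?u)"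
    proof (rule nn_integral_cong_AE)
      have "emeasure ?u {s <.. s + 1} = ennreal (min 1 (1 - s) / 2)" if "s \<in> {-1..1}" for s
      proof -
        have "{-1..1} \<inter> {s <.. s + 1} = {s <.. s + min 1 (1 - s)}" using that by auto
        then show ?thesis using that by (simp add: divide_ennreal flip: ennreal_numeral)
      qed
      then show "AE s in ?u. emeasure ?u {s <.. s + 1} ^ (m - 1) = ennreal (min 1 (1 - s) / 2) ^ (m - 1)"
        by (intro AE_uniform_measureI) auto
    qed
    also have "\<dots> = ennreal ((2 * m * (1::real) ^ (m - 1) - (m - 1) * 1 ^ m) / (m * 2 ^ m))"
      using nn_integral_min_power[of 1 m] m by simp
    finally show "\<dots> = emeasure R (?B i)" ..
  qed
  also have "\<dots> = emeasure R (\<Union>i\<in>J. ?B i)"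
  proof (rule sum_emeasure)
    show "disjoint_family_on ?B J"
      unfolding disjoint_family_on_def
    proof (intro ballI impI equals0I)
      fix i j z assume "i \<in> J" "j \<in> J" "i \<noteq> j" "z \<in> ?B i \<inter> ?B j"
      then have "z j \<in> {z i <.. z i + 1}" "z i \<in> {z j <.. z j + 1}" by blast+
      then show False by simp
    qed
  qed (use B(1) J in auto)
  also have "\<dots> \<le> emeasure R ?S"
  proof (rule emeasure_mono)
    show "(\<Union>i\<in>J. ?B i) \<subseteq> ?S"
    proof safe
      fix k and z :: "'j \<Rightarrow> real" and i j assume *: "k \<in> J" "\<forall>j\<in>J - {k}. z j \<in> {z k <.. z k + 1}" "i \<in> J" "j \<in> J"
      have "z l \<in> {z k .. z k + 1}" if "l \<in> J" for l
        using bspec[OF *(2), of l] that by (cases "l = k") auto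
      from this[OF \<open>i \<in> J\<close>] this[OF \<open>j \<in> J\<close>] show "\<bar>z i - z j\<bar> \<le> 1" by (auto simp: abs_le_iff)
    qed
    have "Measurable.pred R (\<lambda>z. \<forall>i\<in>J. \<forall>j\<in>J. \<bar>z i - z j\<bar> \<le> 1)"
      unfolding R_def using J(1) by (intro pred_intros_finite) measurable
    then show "?S \<in> sets R" by (simp add: pred_def)
  qed
  finally show ?thesis by (simp add: m_def)
qed

subsection \<open>One circle coordinate\<close>

text \<open>The restriction of the product of \<open>M\<close> to the box
  \<open>Pi\<^sub>E J A\<close> and the scaled image of the product of \<open>R\<close> agree on
  boxes. Uniqueness of product measures extends this to every measurable \<open>S\<close>, in
  particular to sets that couple the coordinates.\<close>

lemma emeasure_PiM_rescale:
  fixes J :: "'j set"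
  assumes J: "finite J" and M: "prob_space M" and R: "prob_space R"
    and A: "\<And>j. A j \<in> sets M" and \<phi>: "\<And>j. \<phi> j \<in> R \<rightarrow>\<^sub>M M"
    and eq: "\<And>j B. j \<in> J \<Longrightarrow> B \<in> sets M \<Longrightarrow> emeasure M (A j \<inter> B) = \<kappa> j * emeasure R (\<phi> j -` B \<inter> space R)"
    and S: "S \<in> sets (\<Pi>\<^sub>M j\<in>J. M)"
  shows "emeasure (\<Pi>\<^sub>M j\<in>J. M) (Pi\<^sub>E J A \<inter> S) =
    (\<Prod>j\<in>J. \<kappa> j) * emeasure (\<Pi>\<^sub>M j\<in>J. R) {z \<in> space (\<Pi>\<^sub>M j\<in>J. R). (\<lambda>j\<in>J. \<phi> j (z j)) \<in> S}"
proof -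
  interpret M: prob_space M by fact
  interpret R: prob_space R by fact
  interpret PM: product_prob_space "\<lambda>_ :: 'j. M" by unfold_locales
  interpret PR: product_prob_space "\<lambda>_ :: 'j. R" by unfold_locales
  let ?N = "\<lambda>j. density M (indicator (A j))" and ?f = "\<lambda>z. \<lambda>j\<in>J. \<phi> j (z j)"
  let ?PM = "\<Pi>\<^sub>M j\<in>J. M" and ?PR = "\<Pi>\<^sub>M j\<in>J. R"
  have N: "emeasure (?N j) B = emeasure M (A j \<inter> B)" if "B \<in> sets M" for j B
    using that A by (rule emeasure_restricted[rotated])
  have "finite_measure (?N j)" for j
    by standard (simp add: N)
  then interpret N: product_sigma_finite ?N
    by (simp add: product_sigma_finite_def finite_measure_def)
  have sets_N: "sets (\<Pi>\<^sub>M j\<in>J. ?N j) = sets ?PM" by (intro sets_PiM_cong) auto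
  have PA: "Pi\<^sub>E J A \<in> sets ?PM" using J A by (intro sets_PiM_I_finite) auto
  have f: "?f \<in> ?PR \<rightarrow>\<^sub>M ?PM"
    using \<phi> by measurable
  have "density ?PM (indicator (Pi\<^sub>E J A)) = (\<Pi>\<^sub>M j\<in>J. ?N j)"
  proof (rule N.PiM_eqI[OF J])
    fix B assume "\<And>j. j \<in> J \<Longrightarrow> B j \<in> sets (?N j)"
    then have B: "B j \<in> sets M" if "j \<in> J" for j using that by simp
    have "emeasure (density ?PM (indicator (Pi\<^sub>E J A))) (Pi\<^sub>E J B) = emeasure ?PM (\<Pi>\<^sub>E j\<in>J. A j \<inter> B j)"
      using J B PA by (subst emeasure_restricted) (auto intro!: sets_PiM_I_finite simp: PiE_Int)
    also have "\<dots> = (\<Prod>j\<in>J. emeasure (?N j) (B j))"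
      using J A B by (subst PM.emeasure_PiM) (auto simp: N)
    finally show "emeasure (density ?PM (indicator (Pi\<^sub>E J A))) (Pi\<^sub>E J B) = \<dots>" .
  qed (simp add: sets_N)
  moreover have "scale_measure (\<Prod>j\<in>J. \<kappa> j) (distr ?PR ?PM ?f) = (\<Pi>\<^sub>M j\<in>J. ?N j)"
  proof (rule N.PiM_eqI[OF J])
    fix B assume "\<And>j. j \<in> J \<Longrightarrow> B j \<in> sets (?N j)"
    then have B: "B j \<in> sets M" if "j \<in> J" for j using that by simp
    have "?f -` Pi\<^sub>E J B \<inter> space ?PR = (\<Pi>\<^sub>E j\<in>J. \<phi> j -` B j \<inter> space R)"
      by (auto simp: space_PiM PiE_iff extensional_def)
    then have "emeasure (distr ?PR ?PM ?f) (Pi\<^sub>E J B) = emeasure ?PR (\<Pi>\<^sub>E j\<in>J. \<phi> j -` B j \<inter> space R)"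
      using J B f by (subst emeasure_distr) (auto intro!: sets_PiM_I_finite)
    also have "\<dots> = (\<Prod>j\<in>J. emeasure R (\<phi> j -` B j \<inter> space R))"
      by (rule PR.emeasure_PiM[OF J]) (rule measurable_sets[OF \<phi> B])
    finally show "emeasure (scale_measure (\<Prod>j\<in>J. \<kappa> j) (distr ?PR ?PM ?f)) (Pi\<^sub>E J B) = (\<Prod>j\<in>J. emeasure (?N j) (B j))"
      by (simp add: N B eq prod.distrib)
  qed (simp add: sets_N)
  ultimately have "emeasure (density ?PM (indicator (Pi\<^sub>E J A))) S =
      emeasure (scale_measure (\<Prod>j\<in>J. \<kappa> j) (distr ?PR ?PM ?f)) S" by simp
  then show ?thesis
    using S PA f by (simp add: emeasure_restricted emeasure_distr vimage_def Int_def conj_commute)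
qed

text \<open>The difference of the fractional parts is \<open>a - b\<close> minus an integer in
  \<open>{-1, 0, 1}\<close>. If the integer is nonzero, its absolute value is
  \<open>1 - \<bar>a - b\<bar>\<close>, and the minimum in \<open>circle_dist\<close> still selects
  \<open>\<bar>a - b\<bar>\<close>.\<close>

lemma circle_dist_frac:
  assumes "\<bar>a - b\<bar> \<le> 1 / 2"
  shows "circle_dist (frac a) (frac b) = \<bar>a - b\<bar>"
proof -
  define k where "k = \<lfloor>a\<rfloor> - \<lfloor>b\<rfloor>"
  have fr: "frac a - frac b = (a - b) - k" by (simp add: frac_def k_def)
  have "\<bar>frac a - frac b\<bar> < 1" using frac_lt_1[of a] frac_lt_1[of b] frac_ge_0[of a] frac_ge_0[of b] by linarith
  then have "real_of_int k < 2" "real_of_int k > -2" using fr assms by linarith+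
  then have "k = -1 \<or> k = 0 \<or> k = 1" by linarith
  then show ?thesis
    using fr assms \<open>\<bar>frac a - frac b\<bar> < 1\<close>
    by (elim disjE) (auto simp: circle_dist_def min_def abs_if split: if_splits)
qed

lemma circle_dist_measurable [measurable]:
  assumes [measurable]: "f \<in> borel_measurable M" "g \<in> borel_measurable M"
  shows "(\<lambda>x. circle_dist (f x) (g x)) \<in> borel_measurable M"
  unfolding circle_dist_def by measurable

text \<open>The arc of radius \<open>t\<close> about \<open>p\<close> is
  \<open>[p - t, p + t]\<close> wrapped around the circle, without overlap since
  \<open>t < 1 / 2\<close>. Hence \<open>frac (p + t * z)\<close> carries the uniform law on
  \<open>[-1, 1]\<close> to the uniform law on the arc, whose length is
  \<open>2 * t\<close>.\<close>

lemma emeasure_arc: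
  fixes p t :: real
  assumes p: "0 \<le> p" "p < 1" and t: "0 < t" "t < 1 / 2" and B[measurable]: "B \<in> sets borel"
  shows "emeasure (uniform_measure lborel {0..<1}) ({u. circle_dist p u \<le> t} \<inter> B) =
    ennreal (2 * t) * emeasure (uniform_measure lborel {-1..1}) ((\<lambda>z. frac (p + t * z)) -` B)"
proof -
  define f :: "real \<Rightarrow> ennreal" where "f = (\<lambda>s. indicator {p - t..p + t} s * indicator B (frac s))"
  have frac_m[measurable]: "(\<lambda>s. frac s :: real) \<in> borel_measurable borel" unfolding frac_def by measurable
  have [measurable]: "f \<in> borel_measurable borel" unfolding f_def by measurable
  have vB[measurable]: "(\<lambda>z. frac (p + t * z)) -` B \<in> sets borel"
    using measurable_sets[of "\<lambda>z. frac (p + t * z)" borel borel B] by simp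
  have A[measurable]: "{u. circle_dist p u \<le> t} \<in> sets borel" by measurable
  have fr: "frac (s - 1) = s" "frac (s + 1) = s" "frac s = s" if "0 \<le> s" "s < 1" for s :: real
    using that frac_unique_iff[of "s - 1" s] frac_unique_iff[of "s + 1" s] frac_eq[of s] by auto
  \<comment> \<open>The line is cut at \<open>0\<close> and \<open>1\<close>, and the two outer
    pieces are shifted by one period; since \<open>f\<close> vanishes off
    \<open>[p - t, p + t]\<close>, one shift brings them into \<open>[0, 1)\<close>.\<close>
  have "(\<integral>\<^sup>+s. f s \<partial>lborel) =
      (\<integral>\<^sup>+s. f s * indicator {0..<1} s + f s * indicator {..<0} s + f s * indicator {1..} s \<partial>lborel)"
    by (intro nn_integral_cong) (auto simp: indicator_def)
  also have "\<dots> = (\<integral>\<^sup>+s. f s * indicator {0..<1} s \<partial>lborel) + (\<integral>\<^sup>+s. f s * indicator {..<0} s \<partial>lborel)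
      + (\<integral>\<^sup>+s. f s * indicator {1..} s \<partial>lborel)"
    by (simp add: nn_integral_add)
  also have "(\<integral>\<^sup>+s. f s * indicator {..<0} s \<partial>lborel) = (\<integral>\<^sup>+s. f (s - 1) * indicator {..<0} (s - 1) \<partial>lborel)"
    using nn_integral_real_affine[of "\<lambda>s. f s * indicator {..<0} s" 1 "-1"] by (simp add: algebra_simps)
  also have "(\<integral>\<^sup>+s. f s * indicator {1..} s \<partial>lborel) = (\<integral>\<^sup>+s. f (s + 1) * indicator {1..} (s + 1) \<partial>lborel)"
    using nn_integral_real_affine[of "\<lambda>s. f s * indicator {1..} s" 1 "1"] by (simp add: algebra_simps)
  also have "(\<integral>\<^sup>+s. f s * indicator {0..<1} s \<partial>lborel) + (\<integral>\<^sup>+s. f (s - 1) * indicator {..<0} (s - 1) \<partial>lborel)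
      + (\<integral>\<^sup>+s. f (s + 1) * indicator {1..} (s + 1) \<partial>lborel) =
      (\<integral>\<^sup>+s. f s * indicator {0..<1} s + f (s - 1) * indicator {..<0} (s - 1) + f (s + 1) * indicator {1..} (s + 1) \<partial>lborel)"
    by (simp add: nn_integral_add)
  also have "\<dots> = (\<integral>\<^sup>+s. indicator ({0..<1} \<inter> ({u. circle_dist p u \<le> t} \<inter> B)) s \<partial>lborel)"
  proof (rule nn_integral_cong)
    fix s :: real
    consider "0 \<le> s" "s < 1" | "s < 0" | "s \<ge> 1" by linarith
    then show "f s * indicator {0..<1} s + f (s - 1) * indicator {..<0} (s - 1) + f (s + 1) * indicator {1..} (s + 1) =
      indicator ({0..<1} \<inter> ({u. circle_dist p u \<le> t} \<inter> B)) s"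
    proof cases
      case 1
      \<comment> \<open>The alternatives are reaching \<open>s\<close> directly, from above
        \<open>p\<close> through \<open>0\<close>, and from below \<open>p\<close> through
        \<open>1\<close>, matched by the summands at \<open>s\<close>, \<open>s + 1\<close> and
        \<open>s - 1\<close>. They exclude each other because \<open>t < 1 / 2\<close>.\<close>
      have "circle_dist p s \<le> t \<longleftrightarrow> (p - t \<le> s \<and> s \<le> p + t) \<or> s \<ge> p + 1 - t \<or> s \<le> p + t - 1"
        using p t 1 by (auto simp: circle_dist_def min_def abs_if)
      then show ?thesis using 1 t p by (auto simp: f_def indicator_def fr)
    qed (use p t in \<open>auto simp: f_def indicator_def\<close>)
  qed
  also have "\<dots> = emeasure (uniform_measure lborel {0..<1}) ({u. circle_dist p u \<le> t} \<inter> B)"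
    by (simp add: divide_ennreal_def)
  finally have *: "(\<integral>\<^sup>+s. f s \<partial>lborel) = emeasure (uniform_measure lborel {0..<1}) ({u. circle_dist p u \<le> t} \<inter> B)" .
  have "(\<integral>\<^sup>+s. f s \<partial>lborel) = ennreal t * (\<integral>\<^sup>+z. f (p + t * z) \<partial>lborel)"
    using t nn_integral_real_affine[of f t p] by simp
  also have "(\<integral>\<^sup>+z. f (p + t * z) \<partial>lborel) = (\<integral>\<^sup>+z. indicator ({-1..1} \<inter> (\<lambda>z. frac (p + t * z)) -` B) z \<partial>lborel)"
  proof (rule nn_integral_cong)
    fix z
    have "p - t \<le> p + t * z \<longleftrightarrow> t * (-1) \<le> t * z" "p + t * z \<le> p + t \<longleftrightarrow> t * z \<le> t * 1" by auto
    then have "p + t * z \<in> {p - t..p + t} \<longleftrightarrow> z \<in> {-1..1}"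
      using t by (simp only: atLeastAtMost_iff mult_le_cancel_left_pos)
    then show "f (p + t * z) = indicator ({-1..1} \<inter> (\<lambda>z. frac (p + t * z)) -` B) z"
      by (simp add: f_def indicator_def)
  qed
  also have "ennreal t * \<dots> = ennreal (2 * t) * emeasure (uniform_measure lborel {-1..1}) ((\<lambda>z. frac (p + t * z)) -` B)"
    using t ennreal_divide_self[of 2]
    by (simp add: divide_ennreal_def ennreal_mult mult.assoc mult.left_commute[of 2])
  finally show ?thesis using * by simp
qed

text \<open>Given the position \<open>p\<close> of \<open>v\<close>, the star puts the other
  vertices into arcs about \<open>p\<close>, parametrised as \<open>p + t j * z j\<close>. Radii of
  at most \<open>1 / 4\<close> keep any two of them within \<open>1 / 2\<close>, so circle distances
  are plain differences in which \<open>p\<close> cancels; the integral over \<open>p\<close> is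
  then that of a constant.\<close>

lemma emeasure_star_clique:
  fixes U :: "'v set" and t :: "'v \<Rightarrow> real" and D :: "'v \<Rightarrow> 'v \<Rightarrow> real"
  assumes U: "finite U" "v \<in> U" and t: "\<And>j. j \<in> U - {v} \<Longrightarrow> 0 < t j \<and> t j \<le> 1 / 4"
  defines "J \<equiv> U - {v}" and "M \<equiv> uniform_measure lborel {0..<1::real}"
    and "R \<equiv> uniform_measure lborel {-1..1::real}"
  shows "emeasure (\<Pi>\<^sub>M u\<in>U. M) {y \<in> space (\<Pi>\<^sub>M u\<in>U. M). (\<forall>j\<in>J. circle_dist (y v) (y j) \<le> t j) \<and>
      (\<forall>i\<in>J. \<forall>j\<in>J. circle_dist (y i) (y j) \<le> D i j)} =
    ennreal (\<Prod>j\<in>J. 2 * t j) *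
      emeasure (\<Pi>\<^sub>M j\<in>J. R) {z \<in> space (\<Pi>\<^sub>M j\<in>J. R). \<forall>i\<in>J. \<forall>j\<in>J. \<bar>t i * z i - t j * z j\<bar> \<le> D i j}"
    (is "emeasure _ ?E = _ * emeasure ?PR ?Q")
proof -
  let ?PM = "\<Pi>\<^sub>M j\<in>J. M"
  interpret M: prob_space M unfolding M_def by (rule prob_space_uniform_measure) auto
  interpret R: prob_space R unfolding R_def by (rule uniform_Icc_prob_space)
  interpret product_prob_space "\<lambda>_ :: 'v. M" by unfold_locales
  have [measurable_cong, simp]: "sets M = sets borel" "space M = UNIV" "sets R = sets borel" "space R = UNIV"
    by (simp_all add: M_def R_def)
  have J: "finite J" "v \<notin> J" "insert v J = U" using U by (auto simp: J_def)
  have tJ: "0 < t j" "t j \<le> 1 / 4" if "j \<in> J" for j using t[of j] that by (auto simp: J_def)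
  have E: "?E \<in> sets (\<Pi>\<^sub>M u\<in>U. M)"
    using U J by (intro sets.sets_Collect_conj sets.sets_Collect_finite_All) (auto simp: J_def)
  have Q: "?Q \<in> sets ?PR"
    using J by (intro sets.sets_Collect_finite_All) auto
  define S where "S = {y \<in> space ?PM. \<forall>i\<in>J. \<forall>j\<in>J. circle_dist (y i) (y j) \<le> D i j}"
  have S: "S \<in> sets ?PM"
    unfolding S_def using J by (intro sets.sets_Collect_finite_All) auto
  have inner: "(\<integral>\<^sup>+y. indicator ?E (y(v := p)) \<partial>?PM) = ennreal (\<Prod>j\<in>J. 2 * t j) * emeasure ?PR ?Q"
    if p: "p \<in> {0..<1}" for p
  proof -
    let ?A = "\<lambda>j. if j \<in> J then {u. circle_dist p u \<le> t j} else {}"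
    let ?\<phi> = "\<lambda>j z. frac (p + t j * z)"
    have fm: "(\<lambda>s. frac s :: real) \<in> borel_measurable borel" unfolding frac_def by measurable
    have \<phi>: "?\<phi> j \<in> R \<rightarrow>\<^sub>M M" for j
      using fm by measurable
    have "(\<integral>\<^sup>+y. indicator ?E (y(v := p)) \<partial>?PM) = (\<integral>\<^sup>+y. indicator (Pi\<^sub>E J ?A \<inter> S) y \<partial>?PM)"
      using J by (intro nn_integral_cong)
        (auto simp: indicator_def S_def space_PiM PiE_iff extensional_def)
    also have "\<dots> = emeasure ?PM (Pi\<^sub>E J ?A \<inter> S)"
      using S J by (intro nn_integral_indicator sets.Int sets_PiM_I_finite) auto
    also have "\<dots> = (\<Prod>j\<in>J. ennreal (2 * t j)) * emeasure ?PR {z \<in> space ?PR. (\<lambda>j\<in>J. ?\<phi> j (z j)) \<in> S}"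
    proof (rule emeasure_PiM_rescale[OF J(1) M.prob_space_axioms R.prob_space_axioms _ \<phi> _ S])
      fix j B assume "j \<in> J" "B \<in> sets M"
      then show "emeasure M (?A j \<inter> B) = ennreal (2 * t j) * emeasure R (?\<phi> j -` B \<inter> space R)"
        using p tJ[of j] emeasure_arc[of p "t j" B] by (simp add: M_def R_def)
    qed simp
    also have "(\<Prod>j\<in>J. ennreal (2 * t j)) = ennreal (\<Prod>j\<in>J. 2 * t j)"
      using tJ by (intro prod_ennreal) (auto intro: less_imp_le)
    \<comment> \<open>The two events are compared only for \<open>z\<close> with all entries in
      \<open>[-1, 1]\<close>, which holds almost surely.\<close>
    also have "emeasure ?PR {z \<in> space ?PR. (\<lambda>j\<in>J. ?\<phi> j (z j)) \<in> S} = emeasure ?PR ?Q"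
    proof (rule emeasure_eq_AE)
      have "AE z in ?PR. \<forall>j\<in>J. z j \<in> {-1..1}"
      proof (intro AE_finite_allI J(1) AE_PiM_component R.prob_space_axioms)
        show "AE s in R. s \<in> {-1..1}"
          unfolding R_def by (intro AE_uniform_measureI) auto
      qed
      then show "AE z in ?PR. (z \<in> {z \<in> space ?PR. (\<lambda>j\<in>J. ?\<phi> j (z j)) \<in> S}) = (z \<in> ?Q)"
      proof eventually_elim
        case (elim z)
        have tz: "\<bar>t j * z j\<bar> \<le> 1 / 4" if "j \<in> J" for j
        proof -
          have "\<bar>t j\<bar> * \<bar>z j\<bar> \<le> 1 / 4 * 1"
            using elim that tJ[OF that] by (intro mult_mono) (auto simp: abs_le_iff)
          then show ?thesis by (simp add: abs_mult)
        qed
        have "\<bar>(p + t i * z i) - (p + t j * z j)\<bar> \<le> 1 / 2" if "i \<in> J" "j \<in> J" for i j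
          using tz[OF that(1)] tz[OF that(2)] by linarith
        then have "circle_dist (?\<phi> i (z i)) (?\<phi> j (z j)) = \<bar>t i * z i - t j * z j\<bar>" if "i \<in> J" "j \<in> J" for i j
          using that by (subst circle_dist_frac) auto
        then show ?case by (auto simp: S_def space_PiM PiE_iff)
      qed
      have "(\<lambda>z. \<lambda>j\<in>J. ?\<phi> j (z j)) \<in> ?PR \<rightarrow>\<^sub>M ?PM" using \<phi> by measurable
      from measurable_sets[OF this S] show "{z \<in> space ?PR. (\<lambda>j\<in>J. ?\<phi> j (z j)) \<in> S} \<in> sets ?PR"
        by (simp add: vimage_def Int_def conj_commute)
    qed (rule Q)
    finally show ?thesis .
  qed
  have AE_p: "AE p in M. p \<in> {0..<1}" unfolding M_def by (intro AE_uniform_measureI) auto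
  have "emeasure (\<Pi>\<^sub>M u\<in>U. M) ?E = (\<integral>\<^sup>+y. indicator ?E y \<partial>(\<Pi>\<^sub>M u\<in>insert v J. M))"
    unfolding J(3) using E by simp
  also have "\<dots> = (\<integral>\<^sup>+p. (\<integral>\<^sup>+y. indicator ?E (y(v := p)) \<partial>?PM) \<partial>M)"
    using J(1,2) E by (intro product_nn_integral_insert_rev) (auto simp: J(3))
  also have "\<dots> = (\<integral>\<^sup>+p. ennreal (\<Prod>j\<in>J. 2 * t j) * emeasure ?PR ?Q \<partial>M)"
    by (rule nn_integral_cong_AE[OF eventually_mono[OF AE_p inner]])
  finally show ?thesis by (simp add: M.emeasure_space_1[simplified])
qed

text \<open>After division by \<open>a * b\<close>, the constraint \<open>\<bar>x / b - y / a\<bar> \<le> 1\<close> on \<open>[-1, 1]\<^sup>2\<close> only weakens as \<open>a\<close>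
  and \<open>b\<close> grow, so it lies between its instances at \<open>a = b = 1\<close> and \<open>a = b = c\<close>.\<close>

lemma scaled_diff_le:
  fixes a b x y :: real
  assumes a: "1 \<le> a" and b: "1 \<le> b" and x: "x \<le> 1" and y: "-1 \<le> y" and xy: "x - y \<le> 1"
  shows "a * x - b * y \<le> a * b"
proof -
  have ab: "a \<le> a * b" "b \<le> a * b" using a b by auto
  \<comment> \<open>In the first two cases one term is at most \<open>0\<close> and the other at
    most \<open>b\<close> or \<open>a\<close>. In the third, both coefficients can be enlarged to
    \<open>a * b\<close>.\<close>
  consider "x \<le> 0" | "y \<ge> 0" | "x \<ge> 0" "y \<le> 0" by linarith
  then show ?thesis
  proof cases
    case 1
    have "b * (- y) \<le> b * 1" using b y by (intro mult_left_mono) auto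
    moreover have "a * x \<le> 0" using 1 a by (simp add: mult_le_0_iff)
    ultimately show ?thesis using ab by simp
  next
    case 2
    then have "0 \<le> b * y" "a * x \<le> a * 1" using a b x by auto
    then show ?thesis using ab by simp
  next
    case 3
    have "a * x \<le> a * b * x" "b * (- y) \<le> a * b * (- y)"
      using ab 3 by (intro mult_right_mono; simp)+
    moreover have "a * b * (x - y) \<le> a * b * 1"
      using a b xy by (intro mult_left_mono) auto
    ultimately show ?thesis by (simp add: algebra_simps)
  qed
qed

lemma diff_le_of_scaled:
  fixes a b c x y :: real
  assumes a: "1 \<le> a" "a \<le> c" and b: "1 \<le> b" "b \<le> c" and x: "x \<le> 1" and y: "-1 \<le> y"
    and xy: "a * x - b * y \<le> a * b"
  shows "x - y \<le> c"
proof (cases "x \<ge> 0 \<and> y \<le> 0")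
  case True
  \<comment> \<open>The factor is distributed so that \<open>a * x\<close> and
    \<open>- (b * y)\<close> reappear; the signs of \<open>x\<close> and \<open>y\<close> allow the
    remaining factors \<open>b\<close> and \<open>a\<close> to be replaced by
    \<open>c\<close>.\<close>
  have "a * b * (x - y) = a * (b * x) + b * (a * (- y))" by (simp add: algebra_simps)
  also have "\<dots> \<le> a * (c * x) + b * (c * (- y))"
    using True a b by (intro add_mono mult_left_mono mult_right_mono) auto
  also have "\<dots> = c * (a * x - b * y)" by (simp add: algebra_simps)
  also have "\<dots> \<le> c * (a * b)" using a xy by (intro mult_left_mono) auto
  finally have "a * b * (x - y) \<le> a * b * c" by (simp add: mult_ac)
  moreover have "a * b > 0" using a b by (intro mult_pos_pos) auto
  ultimately show ?thesis by (simp only: mult_le_cancel_left_pos)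
qed (use a x y in linarith)

text \<open>The common factor \<open>r\<close> cancels. For \<open>z\<close> with entries in
  \<open>[-1, 1]\<close>, the event then lies between range at most \<open>1\<close> and range at
  most \<open>c\<close>, and the two range estimates apply.\<close>

lemma scaled_range_bounds:
  fixes J :: "'j set" and a :: "'j \<Rightarrow> real" and c r :: real
  assumes J: "finite J" "card J \<ge> 2" and a: "\<And>j. j \<in> J \<Longrightarrow> 1 \<le> a j \<and> a j \<le> c" and r: "r > 0"
  defines "R \<equiv> \<Pi>\<^sub>M j\<in>J. uniform_measure lborel {-1..1::real}"
  defines "q \<equiv> measure R {z \<in> space R. \<forall>i\<in>J. \<forall>j\<in>J. \<bar>a i * r * z i - a j * r * z j\<bar> \<le> a i * a j * r}"
  shows "(card J + 1) / 2 ^ card J \<le> q" and "q \<le> c ^ (card J - 1) * (card J + 1) / 2 ^ card J"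
proof -
  interpret R: prob_space R unfolding R_def by (intro prob_space_PiM uniform_Icc_prob_space)
  let ?Q = "{z \<in> space R. \<forall>i\<in>J. \<forall>j\<in>J. \<bar>a i * r * z i - a j * r * z j\<bar> \<le> a i * a j * r}"
  let ?S = "\<lambda>c. {z \<in> space R. \<forall>i\<in>J. \<forall>j\<in>J. \<bar>z i - z j\<bar> \<le> (c::real)}"
  have ne: "J \<noteq> {}" using J by auto
  have c: "c \<ge> 1" using ne a by fastforce
  have Q: "?Q \<in> sets R" and S: "?S c \<in> sets R" for c
    unfolding R_def using J by (intro sets.sets_Collect_finite_All; auto)+
  have AE: "AE z in R. \<forall>j\<in>J. \<bar>z j\<bar> \<le> 1"
    unfolding R_def
    by (intro AE_finite_allI J(1) AE_PiM_component uniform_Icc_prob_space AE_uniform_measureI) auto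
  have scale: "\<bar>a i * r * x - a j * r * y\<bar> \<le> a i * a j * r \<longleftrightarrow> \<bar>a i * x - a j * y\<bar> \<le> a i * a j" for i j x y
  proof -
    have "\<bar>a i * r * x - a j * r * y\<bar> = r * \<bar>a i * x - a j * y\<bar>"
      using r abs_mult[of r "a i * x - a j * y"] by (simp add: algebra_simps)
    then show ?thesis using r by (simp add: mult.commute[of _ r])
  qed
  have "emeasure R (?S 1) \<le> emeasure R ?Q"
  proof (intro emeasure_mono_AE[OF eventually_mono[OF AE] Q] impI)
    fix z assume z: "\<forall>j\<in>J. \<bar>z j\<bar> \<le> 1" and S: "z \<in> ?S 1"
    have "a i * z i - a j * z j \<le> a i * a j" if "i \<in> J" "j \<in> J" for i j
      using z S a that by (intro scaled_diff_le) (auto simp: abs_le_iff)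
    \<comment> \<open>The bound for the swapped pair \<open>(j, i)\<close> supplies the other
      sign.\<close>
    then have "\<bar>a i * z i - a j * z j\<bar> \<le> a i * a j" if "i \<in> J" "j \<in> J" for i j
      using that by (simp add: abs_le_iff) (metis mult.commute)
    then show "z \<in> ?Q" using S by (simp add: scale)
  qed
  with emeasure_range_ge[OF J, folded R_def] have "ennreal ((card J + 1) / 2 ^ card J) \<le> emeasure R ?Q"
    by (rule order_trans)
  then show "(card J + 1) / 2 ^ card J \<le> q"
    by (simp add: q_def R.emeasure_eq_measure)
  have "emeasure R ?Q \<le> emeasure R (?S c)"
  proof (intro emeasure_mono_AE[OF eventually_mono[OF AE] S] impI)
    fix z assume z: "\<forall>j\<in>J. \<bar>z j\<bar> \<le> 1" and Q: "z \<in> ?Q"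
    have "z i - z j \<le> c" if ij: "i \<in> J" "j \<in> J" for i j
    proof -
      have "\<bar>a i * z i - a j * z j\<bar> \<le> a i * a j" using Q ij by (simp add: scale)
      then show ?thesis
        using z a ij by (intro diff_le_of_scaled[of "a i" c "a j"]) (auto simp: abs_le_iff)
    qed
    then show "z \<in> ?S c" using Q by (simp add: abs_le_iff)
  qed
  also note emeasure_range_le[OF J(1) ne c, folded R_def]
  finally show "q \<le> c ^ (card J - 1) * (card J + 1) / 2 ^ card J"
    using c by (simp add: q_def R.emeasure_eq_measure)
qed

subsection \<open>Weights\<close>

text \<open>Together with right continuity, this makes \<open>interval_measure\<close> the measure
  with this distribution function.\<close>

lemma weight_cdf_mono:
  assumes "w0 > 0" "\<beta> > 2" "x \<le> y"
  shows "weight_cdf \<beta> w0 x \<le> weight_cdf \<beta> w0 y"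
proof -
  have pow: "(v / w0) powr (1 - \<beta>) \<le> (u / w0) powr (1 - \<beta>)" if "w0 \<le> u" "u \<le> v" for u v
    using assms that by (intro powr_mono2') (auto simp: divide_simps)
  from pow[of w0 y] pow[of x y] show ?thesis
    using assms by (auto simp: weight_cdf_def)
qed

lemma weight_cdf_right_cont:
  assumes "w0 > 0" "\<beta> > 2"
  shows "continuous (at_right a) (weight_cdf \<beta> w0)"
proof (cases "a < w0")
  case True
  have "eventually (\<lambda>x. x < w0) (at_right a)"
    using True eventually_at_right[of a w0] by (auto intro!: exI[of _ w0])
  then have "((\<lambda>x. weight_cdf \<beta> w0 x) \<longlongrightarrow> 0) (at_right a)"
    by (intro tendsto_eventually) (auto elim!: eventually_mono simp: weight_cdf_def)
  moreover have "weight_cdf \<beta> w0 a = 0" using True by (simp add: weight_cdf_def)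
  ultimately show ?thesis by (simp add: continuous_within)
next
  case False
  have "((\<lambda>x. 1 - (x / w0) powr (1 - \<beta>)) \<longlongrightarrow> 1 - (a / w0) powr (1 - \<beta>)) (at_right a)"
    using False assms by (intro tendsto_intros) auto
  moreover have "eventually (\<lambda>x. 1 - (x / w0) powr (1 - \<beta>) = weight_cdf \<beta> w0 x) (at_right a)"
    using False eventually_at_right_less[of a] by (auto elim!: eventually_mono simp: weight_cdf_def)
  ultimately have "((\<lambda>x. weight_cdf \<beta> w0 x) \<longlongrightarrow> 1 - (a / w0) powr (1 - \<beta>)) (at_right a)"
    by (rule Lim_transform_eventually)
  moreover have "weight_cdf \<beta> w0 a = 1 - (a / w0) powr (1 - \<beta>)" using False by (simp add: weight_cdf_def)
  ultimately show ?thesis by (simp add: continuous_within)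
qed

lemma prob_space_weight_measure:
  assumes "w0 > 0" "\<beta> > 2"
  shows "prob_space (weight_measure \<beta> w0)"
proof -
  have "(weight_cdf \<beta> w0 \<longlongrightarrow> 0) at_bot"
    by (intro tendsto_eventually eventually_mono[OF eventually_gt_at_bot[of w0]]) (simp add: weight_cdf_def)
  moreover have "((\<lambda>x. 1 - (x / w0) powr (1 - \<beta>)) \<longlongrightarrow> 1 - 0) at_top"
  proof (intro tendsto_diff tendsto_const tendsto_neg_powr)
    show "filterlim (\<lambda>x. x / w0) at_top at_top"
      using assms filterlim_tendsto_pos_mult_at_top[OF tendsto_const, of "1 / w0" "\<lambda>x. x" at_top]
      by (simp add: filterlim_ident)
  qed (use assms in auto)
  then have "(weight_cdf \<beta> w0 \<longlongrightarrow> 1 - 0) at_top"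
    by (rule Lim_transform_eventually[OF _ eventually_mono[OF eventually_ge_at_top[of w0]]])
      (simp add: weight_cdf_def)
  then have "(weight_cdf \<beta> w0 \<longlongrightarrow> 1) at_top" by simp
  ultimately have "real_distribution (interval_measure (weight_cdf \<beta> w0))"
    using assms by (intro real_distribution_interval_measure weight_cdf_mono weight_cdf_right_cont)
  then show ?thesis by (simp add: weight_measure_def real_distribution_def)
qed

text \<open>\<open>weight_cdf\<close> vanishes at \<open>w0\<close> and below, so every interval
  \<open>(w0 - k, w0]\<close> is null, and these intervals cover all points below
  \<open>w0\<close>.\<close>

lemma AE_weight_measure_ge:
  assumes "w0 > 0" "\<beta> > 2"
  shows "AE x in weight_measure \<beta> w0. w0 \<le> x"
proof -
  have "{w0 - real k <.. w0} \<in> null_sets (weight_measure \<beta> w0)" for k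
    using assms emeasure_interval_measure_Ioc[OF _ weight_cdf_mono weight_cdf_right_cont, of "w0 - real k" w0 w0 \<beta>]
    by (auto simp: null_sets_def weight_measure_def weight_cdf_def)
  then have "(\<Union>k. {w0 - real k <.. w0}) \<in> null_sets (weight_measure \<beta> w0)" by (intro null_sets_UN)
  then show ?thesis
  proof (rule AE_I')
    show "{x \<in> space (weight_measure \<beta> w0). \<not> w0 \<le> x} \<subseteq> (\<Union>k. {w0 - real k <.. w0})"
    proof safe
      fix x assume "\<not> w0 \<le> x"
      moreover obtain k where "w0 - x < real k" using reals_Archimedean2 by blast
      ultimately show "x \<in> (\<Union>k. {w0 - real k <.. w0})" by (intro UN_I[of k]) auto
    qed
  qed
qed

section \<open>Integration over the weights and the choice of \<open>U\<close>\<close>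

text \<open>By Fubini both measures are integrals over \<open>w\<close> and \<open>u\<close> of
  probabilities over the positions, so a comparison of sections carries over. Comparing without
  division covers sections of measure zero as well.\<close>

lemma emeasure_triple_le:
  assumes W: "prob_space W" and X: "prob_space X" and C: "prob_space C"
    and A[measurable]: "A \<in> sets (W \<Otimes>\<^sub>M (X \<Otimes>\<^sub>M C))" and B[measurable]: "B \<in> sets (W \<Otimes>\<^sub>M (X \<Otimes>\<^sub>M C))"
    and le: "AE w in W. \<forall>u\<in>space C.
      emeasure X {x \<in> space X. (w, x, u) \<in> A} \<le> \<kappa> * emeasure X {x \<in> space X. (w, x, u) \<in> B}"
  shows "emeasure (W \<Otimes>\<^sub>M (X \<Otimes>\<^sub>M C)) A \<le> \<kappa> * emeasure (W \<Otimes>\<^sub>M (X \<Otimes>\<^sub>M C)) B"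
proof -
  interpret W: prob_space W by fact
  interpret X: prob_space X by fact
  interpret C: prob_space C by fact
  interpret XC: pair_prob_space X C ..
  have eq: "emeasure (W \<Otimes>\<^sub>M (X \<Otimes>\<^sub>M C)) E = (\<integral>\<^sup>+w. \<integral>\<^sup>+u. emeasure X {x \<in> space X. (w, x, u) \<in> E} \<partial>C \<partial>W)"
    if E: "E \<in> sets (W \<Otimes>\<^sub>M (X \<Otimes>\<^sub>M C))" for E
  proof -
    have "emeasure (W \<Otimes>\<^sub>M (X \<Otimes>\<^sub>M C)) E = (\<integral>\<^sup>+w. emeasure (X \<Otimes>\<^sub>M C) (Pair w -` E) \<partial>W)"
      by (rule XC.emeasure_pair_measure_alt[OF E])
    also have "\<dots> = (\<integral>\<^sup>+w. \<integral>\<^sup>+u. emeasure X {x \<in> space X. (w, x, u) \<in> E} \<partial>C \<partial>W)"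
      using sets.sets_into_space[OF E] sets_Pair1[OF E]
      by (intro nn_integral_cong) (auto simp: XC.emeasure_pair_measure_alt2 space_pair_measure
        intro!: nn_integral_cong arg_cong[where f="emeasure X"])
    finally show ?thesis .
  qed
  \<comment> \<open>Measurability of the section probabilities justifies moving
    \<open>\<kappa>\<close> out of both integrals.\<close>
  have m: "(\<lambda>(w, u). emeasure X {x \<in> space X. (w, x, u) \<in> B}) \<in> borel_measurable (W \<Otimes>\<^sub>M C)"
  proof -
    have "(\<lambda>(w, u). \<integral>\<^sup>+x. indicator B (w, x, u) \<partial>X) \<in> borel_measurable (W \<Otimes>\<^sub>M C)"
      by measurable
    then show ?thesis
      by (rule measurable_cong[THEN iffD1, rotated])
        (auto simp: space_pair_measure simp flip: nn_integral_indicator intro!: nn_integral_cong split: split_indicator)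
  qed
  have "emeasure (W \<Otimes>\<^sub>M (X \<Otimes>\<^sub>M C)) A \<le>
      (\<integral>\<^sup>+w. \<integral>\<^sup>+u. \<kappa> * emeasure X {x \<in> space X. (w, x, u) \<in> B} \<partial>C \<partial>W)"
    unfolding eq[OF A] using le by (intro nn_integral_mono_AE) (auto elim!: eventually_mono intro!: nn_integral_mono)
  also have "\<dots> = (\<integral>\<^sup>+w. \<kappa> * (\<integral>\<^sup>+u. emeasure X {x \<in> space X. (w, x, u) \<in> B} \<partial>C) \<partial>W)"
    using measurable_compose_Pair1[OF _ m] by (intro nn_integral_cong nn_integral_cmult) simp
  also have "\<dots> = \<kappa> * emeasure (W \<Otimes>\<^sub>M (X \<Otimes>\<^sub>M C)) B"
    unfolding eq[OF B] using C.borel_measurable_nn_integral[OF m] by (intro nn_integral_cmult) simp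
  finally show ?thesis .
qed

subsection \<open>Cliques\<close>

lemma by_weight_bounds:
  assumes U: "finite U" "U \<noteq> {}"
  shows "hd (by_weight w U) \<in> U"
    and "u \<in> U \<Longrightarrow> w (hd (by_weight w U)) \<le> w u"
    and "u \<in> U \<Longrightarrow> w u \<le> w (last (by_weight w U))"
proof -
  let ?xs = "by_weight w U"
  have set: "set ?xs = U" using U by (simp add: by_weight_def)
  have ne: "?xs \<noteq> []" using set U by auto
  have sorted: "sorted (map w ?xs)" by (simp add: by_weight_def)
  show "hd ?xs \<in> U" using ne set hd_in_set by blast
  assume "u \<in> U"
  then obtain i where i: "i < length ?xs" "u = ?xs ! i" using set by (metis in_set_conv_nth)
  show "w (hd ?xs) \<le> w u" "w u \<le> w (last ?xs)"
    using i ne sorted_nth_mono[OF sorted, of 0 i] sorted_nth_mono[OF sorted, of i "length ?xs - 1"]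
    by (auto simp: hd_conv_nth last_conv_nth)
qed

lemma torus_dist_le_iff:
  assumes "d \<ge> 1"
  shows "torus_dist d a b \<le> t \<longleftrightarrow> (\<forall>i<d. circle_dist (a i) (b i) \<le> t)"
  unfolding torus_dist_def using assms by (subst Max_le_iff) (auto simp: lessThan_empty_iff)

lemma circle_dist_commute: "circle_dist a b = circle_dist b a"
  by (simp add: circle_dist_def abs_minus_commute)

lemma prob_space_torus_coordinate: "prob_space (uniform_measure lborel {0..<1::real})"
  by (rule prob_space_uniform_measure) auto

lemma prob_space_positions: "prob_space (positions_measure n d)"
  unfolding positions_measure_def torus_measure_def
  by (intro prob_space_PiM prob_space_torus_coordinate)

text \<open>The \<open>d\<close> torus coordinates are independent columns. By \<open>cong\<close>
  only the entries in \<open>U\<close> matter, so each column can be replaced by its marginal on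
  \<open>U\<close>.\<close>

lemma measure_positions_columns:
  fixes P :: "(nat \<Rightarrow> real) \<Rightarrow> bool"
  assumes d: "d \<ge> 1" and U: "U \<subseteq> {..<n}" "U \<noteq> {}"
    and P: "Measurable.pred (\<Pi>\<^sub>M u\<in>U. uniform_measure lborel {0..<1}) P"
    and cong: "\<And>y y'. (\<And>u. u \<in> U \<Longrightarrow> y u = y' u) \<Longrightarrow> P y \<longleftrightarrow> P y'"
  shows "\<P>(x in positions_measure n d. \<forall>i<d. P (\<lambda>u. x u i)) =
    \<P>(y in \<Pi>\<^sub>M u\<in>U. uniform_measure lborel {0..<1}. P y) ^ d"
proof -
  let ?M = "uniform_measure lborel {0..<1::real}"
  let ?N = "\<Pi>\<^sub>M u\<in>{..<n}. ?M" and ?NU = "\<Pi>\<^sub>M u\<in>U. ?M"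
  define A where "A = {y \<in> space ?N. P (restrict y U)}"
  have n: "{..<n} \<noteq> {}" "{..<d} \<noteq> {}" using U d by (auto simp: lessThan_empty_iff)
  have r: "(\<lambda>y. restrict y U) \<in> ?N \<rightarrow>\<^sub>M ?NU" using U by (intro measurable_restrict_subset)
  have A: "A \<in> sets ?N"
    using measurable_compose[OF r P] by (simp add: A_def pred_def)
  have "distr ?N ?NU (\<lambda>y. restrict y U) = ?NU"
    using U by (intro distr_PiM_reindex[where f="\<lambda>u. u"] prob_space_torus_coordinate) auto
  then have "\<P>(y in ?NU. P y) = measure (distr ?N ?NU (\<lambda>y. restrict y U)) {y \<in> space ?NU. P y}"
    by simp
  also have "\<dots> = measure ?N A"
    using P by (subst measure_distr[OF r])
      (auto simp: pred_def A_def space_PiM intro!: arg_cong[where f="measure _"])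
  finally have "\<P>(y in ?NU. P y) ^ d = measure ?N A ^ card {..<d}" by simp
  also have "\<dots> = measure (positions_measure n d)
      {x \<in> space (positions_measure n d). \<forall>i\<in>{..<d}. (\<lambda>u\<in>{..<n}. x u i) \<in> A}"
    unfolding positions_measure_def torus_measure_def
    by (rule measure_PiM_PiM_columns[symmetric, OF prob_space_torus_coordinate n(2) _ n(1) A]) simp
  also have "\<dots> = \<P>(x in positions_measure n d. \<forall>i<d. P (\<lambda>u. x u i))"
  proof -
    have "P (restrict (\<lambda>u\<in>{..<n}. x u i) U) = P (\<lambda>u. x u i)" for x :: "nat \<Rightarrow> nat \<Rightarrow> real" and i
      using U by (intro cong) auto
    then show ?thesis
      by (intro arg_cong[where f="measure _"]) (auto simp: A_def space_PiM)
  qed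
  finally show ?thesis ..
qed

text \<open>The star has probability \<open>K ^ d\<close> and star and clique together have
  probability \<open>(K * q) ^ d\<close>, where \<open>K\<close> and \<open>q\<close> belong to a
  single coordinate, so \<open>p = q ^ d\<close> works. The product form of the last equation is the
  one that integrates over the weights.\<close>

lemma clique_given_weights:
  fixes lam w0 c :: real and n d k :: nat and w :: "nat \<Rightarrow> real" and U :: "nat set"
  assumes lam: "lam > 0" and w0: "w0 > 0" and d: "d \<ge> 1" and k: "k \<ge> 3" and c: "c \<ge> 1"
    and w: "\<And>v. v < n \<Longrightarrow> w v \<ge> w0" and U: "U \<in> k_subsets n k"
    and wc: "weight_condition lam n d c w U"
  defines "L \<equiv> (1 / 2) ^ (d * (k - 1)) * real k ^ d"
  obtains p where "L \<le> p" and "p \<le> c ^ (d * (k - 2)) * L"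
    and "\<P>(x in positions_measure n d. star_event lam n d c w x U) > 0"
    and "\<P>(x in positions_measure n d. is_clique lam n d w x U \<and> star_event lam n d c w x U) =
      p * \<P>(x in positions_measure n d. star_event lam n d c w x U)"
proof -
  let ?M = "uniform_measure lborel {0..<1::real}"
  have U': "U \<subseteq> {..<n}" "card U = k" using U by (auto simp: k_subsets_def)
  then have fin: "finite U" and ne: "U \<noteq> {}" using k finite_subset by auto
  define v where "v = hd (by_weight w U)"
  note bounds = by_weight_bounds[OF fin ne, where w=w, folded v_def]
  define J where "J = U - {v}"
  have J: "finite J" "card J = k - 1" "v \<notin> J" "U = insert v J" using fin U' bounds(1) by (auto simp: J_def)
  define R where "R = (\<Pi>\<^sub>M j\<in>J. uniform_measure lborel {-1..1::real})"
  interpret R: prob_space R unfolding R_def by (intro prob_space_PiM uniform_Icc_prob_space)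
  have wpos: "w u > 0" if "u \<in> U" for u using w[of u] w0 that U' by auto
  define s where "s = tau lam d * real n"
  have "n > 0" using U' ne by (cases n) auto
  then have s: "s > 0" using lam by (simp add: s_def tau_def)
  \<comment> \<open>\<open>r\<close> is the threshold of two vertices of least weight, and
    \<open>a u\<close> is the factor by which \<open>u\<close> enlarges it. Taking
    \<open>d\<close>-th roots turns the factor \<open>c ^ d\<close> of the weight condition into
    \<open>a u \<le> c\<close>.\<close>
  define r where "r = ((w v)\<^sup>2 / s) powr (1 / real d)"
  define a where "a u = (w u / w v) powr (1 / real d)" for u
  have r: "r > 0" using wpos[OF bounds(1)] s by (simp add: r_def)
  have cr: "c\<^sup>2 * r \<le> 1 / 4" and wU: "w u \<le> c ^ d * w v" if "u \<in> U" for u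
    using wc bounds(3)[of u] that
    by (auto simp: weight_condition_def Let_def r_def s_def v_def)
  have thr: "threshold lam n d (w u) (w u') = a u * a u' * r" if "u \<in> U" "u' \<in> U" for u u'
  proof -
    have "w u * w u' / s = (w u / w v) * (w u' / w v) * ((w v)\<^sup>2 / s)"
      using wpos[OF bounds(1)] by (simp add: power2_eq_square)
    then show ?thesis
      using wpos[OF that(1)] wpos[OF that(2)] wpos[OF bounds(1)] s
      by (simp add: threshold_def a_def r_def flip: s_def powr_mult)
  qed
  have av: "a v = 1" using wpos[OF bounds(1)] by (simp add: a_def)
  have a: "1 \<le> a u \<and> a u \<le> c" if "u \<in> U" for u
  proof
    have "1 \<le> w u / w v" using bounds(2)[OF that] wpos[OF bounds(1)] by simp
    then show "1 \<le> a u" using d by (simp add: a_def ge_one_powr_ge_zero)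
    have "a u \<le> (c ^ d) powr (1 / real d)"
      using wU[OF that] wpos[OF bounds(1)] wpos[OF that]
      by (auto simp: a_def divide_simps intro!: powr_mono2)
    also have "\<dots> = c" using c d by (simp add: powr_powr flip: powr_realpow)
    finally show "a u \<le> c" .
  qed
  have t: "0 < a j * r \<and> a j * r \<le> 1 / 4" if "j \<in> U - {v}" for j
  proof
    have aj: "1 \<le> a j" "a j \<le> c" using a[of j] that by auto
    then show "0 < a j * r" using r by simp
    have "a j \<le> c\<^sup>2" using aj c mult_mono[of "a j" c 1 c] by (simp add: power2_eq_square)
    then have "a j * r \<le> c\<^sup>2 * r" using r by simp
    then show "a j * r \<le> 1 / 4" using cr[OF bounds(1)] by simp
  qed
  \<comment> \<open>\<open>D\<close> is the bound between two leaves of the star. The constant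
    \<open>1\<close> is no restriction on a circle and gives the star; \<open>a i * a j * r\<close>
    gives the clique.\<close>
  define E where "E D y \<longleftrightarrow> (\<forall>j\<in>J. circle_dist (y v) (y j) \<le> a j * r) \<and>
    (\<forall>i\<in>J. \<forall>j\<in>J. circle_dist (y i) (y j) \<le> D i j)" for D and y :: "nat \<Rightarrow> real"
  define K where "K = (\<Prod>j\<in>J. 2 * (a j * r))"
  have K: "K > 0" unfolding K_def using t by (intro prod_pos) (auto simp: J_def)
  have prob_E: "\<P>(x in positions_measure n d. \<forall>i<d. E D (\<lambda>u. x u i)) =
      (K * \<P>(z in R. \<forall>i\<in>J. \<forall>j\<in>J. \<bar>a i * r * z i - a j * r * z j\<bar> \<le> D i j)) ^ d" for D
  proof -
    have "Measurable.pred (\<Pi>\<^sub>M u\<in>U. ?M) (E D)"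
      unfolding E_def pred_def
      using J bounds(1) by (intro sets.sets_Collect_conj sets.sets_Collect_finite_All) auto
    then have "\<P>(x in positions_measure n d. \<forall>i<d. E D (\<lambda>u. x u i)) = \<P>(y in \<Pi>\<^sub>M u\<in>U. ?M. E D y) ^ d"
      by (intro measure_positions_columns d U' ne) (auto simp: E_def J(4))
    moreover have "\<P>(y in \<Pi>\<^sub>M u\<in>U. ?M. E D y) =
        K * \<P>(z in R. \<forall>i\<in>J. \<forall>j\<in>J. \<bar>a i * r * z i - a j * r * z j\<bar> \<le> D i j)"
      using emeasure_star_clique[OF fin bounds(1), of "\<lambda>j. a j * r" D] t K
      by (simp add: measure_def E_def K_def enn2real_mult flip: J_def R_def)
    ultimately show ?thesis by simp
  qed
  have star_iff: "star_event lam n d c w x U \<longleftrightarrow> (\<forall>i<d. E (\<lambda>_ _. 1) (\<lambda>u. x u i))" for x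
  proof -
    have "circle_dist y z \<le> 1" for y z by (simp add: circle_dist_def min_def)
    moreover have "adjacent lam n d w x v j \<longleftrightarrow> (\<forall>i<d. circle_dist (x v i) (x j i) \<le> a j * r)" if "j \<in> J" for j
      using that J bounds(1) by (auto simp: adjacent_def torus_dist_le_iff[OF d] thr av)
    ultimately show ?thesis
      using wc by (auto simp: star_event_def Let_def E_def simp flip: v_def J_def)
  qed
  have clique_iff: "is_clique lam n d w x U \<and> star_event lam n d c w x U \<longleftrightarrow>
      (\<forall>i<d. E (\<lambda>i j. a i * a j * r) (\<lambda>u. x u i))" for x
  proof -
    have adj: "adjacent lam n d w x u u' \<longleftrightarrow> (\<forall>i<d. circle_dist (x u i) (x u' i) \<le> a u * a u' * r)"
      if "u \<in> U" "u' \<in> U" "u \<noteq> u'" for u u'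
      using that by (simp add: adjacent_def torus_dist_le_iff[OF d] thr)
    \<comment> \<open>\<open>E\<close> also ranges over equal indices, where the distance is
      \<open>0\<close>.\<close>
    have refl: "circle_dist y y \<le> a u * a u * r" for y u
      using r by (simp add: circle_dist_def)
    have "is_clique lam n d w x U \<longleftrightarrow> (\<forall>i<d. E (\<lambda>i j. a i * a j * r) (\<lambda>u. x u i))"
    proof
      assume cl: "is_clique lam n d w x U"
      have "circle_dist (x u i) (x u' i) \<le> a u * a u' * r" if "u \<in> U" "u' \<in> U" "i < d" for u u' i
        using cl that adj[of u u'] refl by (cases "u = u'") (auto simp: is_clique_def)
      then show "\<forall>i<d. E (\<lambda>i j. a i * a j * r) (\<lambda>u. x u i)"
        using av by (auto simp: E_def J(4)) (metis mult_1)
    next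
      assume E: "\<forall>i<d. E (\<lambda>i j. a i * a j * r) (\<lambda>u. x u i)"
      have "circle_dist (x u i) (x u' i) \<le> a u * a u' * r" if uu: "u \<in> U" "u' \<in> U" "i < d" for u u' i
      proof -
        consider "u = u'" | "u = v" "u' \<in> J" | "u' = v" "u \<in> J" | "u \<in> J" "u' \<in> J"
          using uu J(4) by auto
        then show ?thesis
          using E uu refl av by cases (auto simp: E_def circle_dist_commute[of _ "x v i"])
      qed
      then show "is_clique lam n d w x U" using adj by (simp add: is_clique_def)
    qed
    moreover have "E (\<lambda>_ _. 1) y" if "E D y" for D y
      using that by (auto simp: E_def circle_dist_def min_def)
    ultimately show ?thesis unfolding star_iff by blast
  qed
  define q where "q = \<P>(z in R. \<forall>i\<in>J. \<forall>j\<in>J. \<bar>a i * r * z i - a j * r * z j\<bar> \<le> a i * a j * r)"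
  \<comment> \<open>For \<open>D = 1\<close> the second factor of \<open>prob_E\<close> must be
    \<open>1\<close>: almost surely all offsets are at most \<open>1 / 4\<close> in absolute
    value.\<close>
  have "\<P>(z in R. \<forall>i\<in>J. \<forall>j\<in>J. \<bar>a i * r * z i - a j * r * z j\<bar> \<le> 1) = 1"
  proof (subst R.prob_Collect_eq_1)
    have "AE z in R. \<forall>j\<in>J. \<bar>z j\<bar> \<le> 1"
      unfolding R_def
      by (intro AE_finite_allI J(1) AE_PiM_component uniform_Icc_prob_space AE_uniform_measureI) auto
    then show "AE z in R. \<forall>i\<in>J. \<forall>j\<in>J. \<bar>a i * r * z i - a j * r * z j\<bar> \<le> 1"
    proof eventually_elim
      case (elim z)
      have az: "\<bar>a j * r * z j\<bar> \<le> 1 / 4" if "j \<in> J" for j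
      proof -
        have "\<bar>a j * r\<bar> * \<bar>z j\<bar> \<le> 1 / 4 * 1"
          using elim that t[of j] by (intro mult_mono) (auto simp: J_def abs_le_iff)
        then show ?thesis by (simp add: abs_mult)
      qed
      show ?case
      proof (intro ballI)
        fix i j assume "i \<in> J" "j \<in> J"
        from az[OF this(1)] az[OF this(2)] show "\<bar>a i * r * z i - a j * r * z j\<bar> \<le> 1" by linarith
      qed
    qed
    show "{z \<in> space R. \<forall>i\<in>J. \<forall>j\<in>J. \<bar>a i * r * z i - a j * r * z j\<bar> \<le> 1} \<in> sets R"
      unfolding R_def using J(1) by (intro sets.sets_Collect_finite_All) auto
  qed
  then have star: "\<P>(x in positions_measure n d. star_event lam n d c w x U) = K ^ d"
    unfolding star_iff using prob_E[of "\<lambda>_ _. 1"] by simp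
  have clique: "\<P>(x in positions_measure n d. is_clique lam n d w x U \<and> star_event lam n d c w x U) = q ^ d * K ^ d"
    unfolding clique_iff prob_E by (simp add: q_def power_mult_distrib)
  have q: "k / 2 ^ (k - 1) \<le> q" "q \<le> c ^ (k - 2) * k / 2 ^ (k - 1)"
  proof -
    have "card J \<ge> 2" and aJ: "\<And>j. j \<in> J \<Longrightarrow> 1 \<le> a j \<and> a j \<le> c"
      using J(2) k a by (auto simp: J_def)
    note bd = scaled_range_bounds[where a=a, OF J(1) this r, folded R_def, folded q_def]
    have "card J + 1 = k" "card J - 1 = k - 2" using J(2) k by auto
    then show "k / 2 ^ (k - 1) \<le> q" "q \<le> c ^ (k - 2) * k / 2 ^ (k - 1)"
      using bd J(2) by simp_all
  qed
  have L: "L = (k / 2 ^ (k - 1)) ^ d"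
    by (simp add: L_def power_divide power_mult mult.commute[of d])
  show ?thesis
  proof (rule that[of "q ^ d"])
    show "L \<le> q ^ d" unfolding L using q by (intro power_mono) auto
    have "q ^ d \<le> (c ^ (k - 2) * (k / 2 ^ (k - 1))) ^ d"
      using q by (intro power_mono) (auto simp: q_def)
    then show "q ^ d \<le> c ^ (d * (k - 2)) * L"
      by (simp add: L power_mult_distrib power_divide power_mult mult.commute[of d])
    show "\<P>(x in positions_measure n d. star_event lam n d c w x U) > 0" using K star by simp
  qed (use star clique in simp)
qed


section \<open>Measurability and the unconditional bounds\<close>

text \<open>With quantifiers over the fixed set \<open>{..<n}\<close> and membership in
  \<open>U\<close> as a premise, being a clique is a finite combination of measurable conditions on
  single coordinates.\<close>

lemma is_clique_measurable:
  assumes d: "d \<ge> 1"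
  shows "{(w, x, U) \<in> space (girg_measure n \<beta> w0 d k). is_clique lam n d w x U} \<in> sets (girg_measure n \<beta> w0 d k)"
proof -
  let ?G = "girg_measure n \<beta> w0 d k"
  have U: "U \<subseteq> {..<n}" if "(w, x, U) \<in> space ?G" for w x U
    using that by (auto simp: girg_measure_def space_pair_measure space_uniform_count_measure k_subsets_def)
  have *: "is_clique lam n d w x U \<longleftrightarrow> (\<forall>u\<in>{..<n}. \<forall>v\<in>{..<n}. u \<in> U \<and> v \<in> U \<and> u \<noteq> v \<longrightarrow>
      (\<forall>i\<in>{..<d}. circle_dist (x u i) (x v i) \<le> threshold lam n d (w u) (w v)))"
    if "(w, x, U) \<in> space ?G" for w x U
    using U[OF that] by (auto simp: is_clique_def adjacent_def torus_dist_le_iff[OF d])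
  have w: "(\<lambda>\<omega>. fst \<omega> u) \<in> borel_measurable ?G" if "u < n" for u
  proof -
    have "(\<lambda>f. f u) \<in> weights_measure n \<beta> w0 \<rightarrow>\<^sub>M weight_measure \<beta> w0"
      unfolding weights_measure_def using that by (intro measurable_component_singleton) auto
    then have "(\<lambda>f. f u) \<in> borel_measurable (weights_measure n \<beta> w0)"
      by (simp add: weight_measure_def cong: measurable_cong_sets)
    then show ?thesis unfolding girg_measure_def by (rule measurable_compose[OF measurable_fst])
  qed
  have x: "(\<lambda>\<omega>. fst (snd \<omega>) u i) \<in> borel_measurable ?G" if "u < n" "i < d" for u i
  proof -
    have "(\<lambda>f. f u) \<in> positions_measure n d \<rightarrow>\<^sub>M torus_measure d"
      unfolding positions_measure_def using that by (intro measurable_component_singleton) auto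
    moreover have "(\<lambda>f. f i) \<in> torus_measure d \<rightarrow>\<^sub>M uniform_measure lborel {0..<1}"
      unfolding torus_measure_def using that by (intro measurable_component_singleton) auto
    ultimately have "(\<lambda>f. f u i) \<in> positions_measure n d \<rightarrow>\<^sub>M uniform_measure lborel {0..<1}"
      by (rule measurable_compose)
    then have "(\<lambda>f. f u i) \<in> borel_measurable (positions_measure n d)"
      by (simp cong: measurable_cong_sets)
    then show ?thesis
      unfolding girg_measure_def
      by (rule measurable_compose[OF measurable_compose[OF measurable_snd measurable_fst]])
  qed
  have mem: "Measurable.pred ?G (\<lambda>\<omega>. u \<in> snd (snd \<omega>))" for u
  proof -
    have "Measurable.pred (uniform_count_measure (k_subsets n k)) (\<lambda>U. u \<in> U)"
      by (auto simp: pred_def sets_uniform_count_measure space_uniform_count_measure)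
    then show ?thesis
      unfolding girg_measure_def
      by (rule measurable_compose[OF measurable_compose[OF measurable_snd measurable_snd]])
  qed
  have "{(w, x, U) \<in> space ?G. is_clique lam n d w x U} =
    {\<omega> \<in> space ?G. \<forall>u\<in>{..<n}. \<forall>v\<in>{..<n}. u \<in> snd (snd \<omega>) \<and> v \<in> snd (snd \<omega>) \<and> u \<noteq> v \<longrightarrow>
      (\<forall>i\<in>{..<d}. circle_dist (fst (snd \<omega>) u i) (fst (snd \<omega>) v i) \<le> threshold lam n d (fst \<omega> u) (fst \<omega> v))}"
    using * by auto
  also have "\<dots> \<in> sets ?G"
    using w x mem unfolding threshold_def
    by (intro sets.sets_Collect_finite_All sets.sets_Collect_imp sets.sets_Collect_conj finite_lessThan)
      (auto simp: pred_def)
  finally show ?thesis .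
qed

text \<open>A conditional probability is a quotient, with value \<open>0\<close> if the condition
  has measure \<open>0\<close>; hence the positivity premise in the first conjunct. For fixed
  weights as in the second conjunct the star always has positive probability.\<close>

theorem theorem3:
  fixes lam w0 \<beta> c :: real and n d k :: nat
  assumes "lam > 0" and "w0 > 0" and "\<beta> > 2" and "d \<ge> 1"
    and "k \<ge> 3" and "k \<le> n" and "c \<ge> 1"
  defines "L \<equiv> (1 / 2) ^ (d * (k - 1)) * real k ^ d"
  shows
    "(\<P>((w, x, U) in girg_measure n \<beta> w0 d k. star_event lam n d c w x U) > 0 \<longrightarrow>
        \<P>((w, x, U) in girg_measure n \<beta> w0 d k. is_clique lam n d w x U \<bar> star_event lam n d c w x U)
          \<in> {L .. c ^ (d * (k - 2)) * L}) \<and>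
     (\<forall>w U. (\<forall>v<n. w v \<ge> w0) \<and> U \<in> k_subsets n k \<and> weight_condition lam n d c w U \<longrightarrow>
        \<P>(x in positions_measure n d. is_clique lam n d w x U \<bar> star_event lam n d c w x U)
          \<in> {L .. c ^ (d * (k - 2)) * L})"
proof (intro conjI impI allI)
  fix w U
  assume "(\<forall>v<n. w v \<ge> w0) \<and> U \<in> k_subsets n k \<and> weight_condition lam n d c w U"
  then have w: "\<And>v. v < n \<Longrightarrow> w0 \<le> w v" and U: "U \<in> k_subsets n k" "weight_condition lam n d c w U"
    by auto
  obtain p where "L \<le> p" "p \<le> c ^ (d * (k - 2)) * L"
    "\<P>(x in positions_measure n d. star_event lam n d c w x U) > 0"
    "\<P>(x in positions_measure n d. is_clique lam n d w x U \<and> star_event lam n d c w x U) =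
      p * \<P>(x in positions_measure n d. star_event lam n d c w x U)"
    unfolding L_def by (rule clique_given_weights[OF assms(1,2,4,5,7) w U])
  then show "\<P>(x in positions_measure n d. is_clique lam n d w x U \<bar> star_event lam n d c w x U)
      \<in> {L .. c ^ (d * (k - 2)) * L}"
    by (simp add: cond_prob_def)
next
  let ?G = "girg_measure n \<beta> w0 d k" and ?X = "positions_measure n d"
  let ?W = "weights_measure n \<beta> w0" and ?C = "uniform_count_measure (k_subsets n k)"
  let ?S = "{\<omega> \<in> space ?G. case \<omega> of (w, x, U) \<Rightarrow> star_event lam n d c w x U}"
  let ?SC = "{\<omega> \<in> space ?G. (case \<omega> of (w, x, U) \<Rightarrow> is_clique lam n d w x U) \<and>
    (case \<omega> of (w, x, U) \<Rightarrow> star_event lam n d c w x U)}"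
  assume "\<P>((w, x, U) in ?G. star_event lam n d c w x U) > 0"
  also have "{(w, x, U) \<in> space ?G. star_event lam n d c w x U} = ?S" by auto
  finally have pos: "measure ?G ?S > 0" .
  \<comment> \<open>A non-measurable set has measure \<open>0\<close> by convention.\<close>
  have S: "?S \<in> sets ?G"
  proof (rule ccontr)
    assume "?S \<notin> sets ?G"
    from measure_notin_sets[OF this] pos show False by (simp only: less_irrefl)
  qed
  have "?SC = ?S \<inter> {(w, x, U) \<in> space ?G. is_clique lam n d w x U}" by auto
  then have SC: "?SC \<in> sets ?G"
    using S is_clique_measurable[OF \<open>d \<ge> 1\<close>, of n \<beta> w0 k lam] by (simp only: sets.Int)
  \<comment> \<open>This witness makes \<open>k_subsets n k\<close> nonempty, so that choosing
    \<open>U\<close> uniformly is a probability measure.\<close>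
  have "{..<k} \<in> k_subsets n k" using \<open>k \<le> n\<close> by (auto simp: k_subsets_def)
  moreover have "finite (k_subsets n k)" by (simp add: k_subsets_def)
  ultimately have C: "prob_space ?C" by (intro prob_space_uniform_count_measure) auto
  have W: "prob_space ?W"
    unfolding weights_measure_def using assms by (intro prob_space_PiM prob_space_weight_measure)
  interpret X: prob_space ?X by (rule prob_space_positions)
  interpret WXC: prob_space ?G
    unfolding girg_measure_def using W C X.prob_space_axioms
    by (intro prob_space_pair)
  have L: "L > 0" using \<open>k \<ge> 3\<close> by (simp add: L_def)
  let ?p = "\<lambda>E w U. emeasure ?X {x \<in> space ?X. (w, x, U) \<in> E}"
  have AE_w: "AE w in ?W. \<forall>v\<in>{..<n}. w0 \<le> w v"
    unfolding weights_measure_def using assms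
    by (intro AE_finite_allI AE_PiM_component prob_space_weight_measure AE_weight_measure_ge) auto
  \<comment> \<open>Without division the bounds hold for every \<open>U\<close>: where the weight
    condition fails, the star event is empty and all terms vanish.\<close>
  have AE_bounds: "AE w in ?W. \<forall>U\<in>space ?C.
      ?p ?S w U \<le> ennreal (1 / L) * ?p ?SC w U \<and> ?p ?SC w U \<le> ennreal (c ^ (d * (k - 2)) * L) * ?p ?S w U"
    using AE_w AE_space
  proof eventually_elim
    case (elim w)
    show ?case
    proof
      fix U assume U: "U \<in> space ?C"
      then have Uk: "U \<in> k_subsets n k" by (simp add: space_uniform_count_measure)
      have sp: "(w, x, U) \<in> space ?G \<longleftrightarrow> x \<in> space ?X" for x
        using elim(2) U by (auto simp: girg_measure_def space_pair_measure)
      have pS: "?p ?S w U = ennreal (\<P>(x in ?X. star_event lam n d c w x U))"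
        by (simp add: sp X.emeasure_eq_measure cong: conj_cong)
      have pSC: "?p ?SC w U = ennreal (\<P>(x in ?X. is_clique lam n d w x U \<and> star_event lam n d c w x U))"
        by (simp add: sp X.emeasure_eq_measure cong: conj_cong)
      show "?p ?S w U \<le> ennreal (1 / L) * ?p ?SC w U \<and> ?p ?SC w U \<le> ennreal (c ^ (d * (k - 2)) * L) * ?p ?S w U"
      proof (cases "weight_condition lam n d c w U")
        case False
        then show ?thesis unfolding pS pSC by (simp add: star_event_def)
      next
        case True
        obtain p where p: "L \<le> p" "p \<le> c ^ (d * (k - 2)) * L"
          "\<P>(x in ?X. is_clique lam n d w x U \<and> star_event lam n d c w x U) =
            p * \<P>(x in ?X. star_event lam n d c w x U)"
          unfolding L_def
          by (rule clique_given_weights[OF assms(1,2,4,5,7) _ Uk True]) (use elim(1) in auto)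
        have "1 * \<P>(x in ?X. star_event lam n d c w x U) \<le> 1 / L * p * \<P>(x in ?X. star_event lam n d c w x U)"
          using p L by (intro mult_right_mono) auto
        moreover have "p * \<P>(x in ?X. star_event lam n d c w x U) \<le> c ^ (d * (k - 2)) * L * \<P>(x in ?X. star_event lam n d c w x U)"
          using p by (intro mult_right_mono) auto
        ultimately show ?thesis
          using L \<open>c \<ge> 1\<close> unfolding pS pSC p(3)
          by (auto simp: ennreal_mult'[symmetric] mult.assoc intro!: ennreal_leI)
      qed
    qed
  qed
  \<comment> \<open>The lower bound is read as an upper bound on the star event with factor
    \<open>1 / L\<close>, so that the same comparison of sections serves both directions.\<close>
  have "emeasure ?G ?S \<le> ennreal (1 / L) * emeasure ?G ?SC"
    by (rule emeasure_triple_le[OF W X.prob_space_axioms C, folded girg_measure_def,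
          OF S SC eventually_mono[OF AE_bounds]]) blast
  then have lower: "L * measure ?G ?S \<le> measure ?G ?SC"
    unfolding WXC.emeasure_eq_measure using L by (simp add: ennreal_mult'[symmetric] field_simps)
  have "emeasure ?G ?SC \<le> ennreal (c ^ (d * (k - 2)) * L) * emeasure ?G ?S"
    by (rule emeasure_triple_le[OF W X.prob_space_axioms C, folded girg_measure_def,
          OF SC S eventually_mono[OF AE_bounds]]) blast
  then have upper: "measure ?G ?SC \<le> c ^ (d * (k - 2)) * L * measure ?G ?S"
    unfolding WXC.emeasure_eq_measure using L \<open>c \<ge> 1\<close> by (simp add: ennreal_mult'[symmetric])
  show "\<P>((w, x, U) in ?G. is_clique lam n d w x U \<bar> star_event lam n d c w x U)
      \<in> {L .. c ^ (d * (k - 2)) * L}"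
    using pos lower upper unfolding cond_prob_def atLeastAtMost_iff
    by (simp only: pos_le_divide_eq pos_divide_le_eq simp_thms)
qed

end
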